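(* Consider the directed graph $G$ whose vertices are the following $2\times 2$ complex matrices (here $\lambda,\mu,\nu,\sigma,\tau\in\mathbb C$ are parameters, and matrices that differ only by a permutation of direct summands are regarded as the same vertex, i.e. $\operatorname{diag}(\mu,\nu)$ and $\operatorname{diag}(\nu,\mu)$ are the same vertex, and $\operatorname{diag}(\lambda,-\lambda)$ and $\operatorname{diag}(-\lambda,\lambda)$ are the same vertex): (V1) $\begin{bmatrix}\mu&0\\0&\nu\end{bmatrix}$ with $|\mu|=|\nu|=1$, $\mu\neq\pm\nu$; (V2) $\begin{bmatrix}0&1\\ \sigma&0\end{bmatrix}$ with $|\sigma|<1$; (V3) $\begin{bmatrix}0&\tau\\ \tau&\tau i\end{bmatrix}$ with $|\tau|=1$; (V4) $\begin{bmatrix}\lambda&0\\0&\lambda\end{bmatrix}$ with $|\lambda|=1$; (V5) $\begin{bmatrix}\lambda&0\\0&-\lambda\end{bmatrix}$ with $|\lambda|=1$; (V6) $\begin{bmatrix}\lambda&0\\0&0\end{bmatrix}$ with $|\lambda|=1$; (V7) $\begin{bmatrix}0&0\\0&0\end{bmatrix}$, and whose arrows are exactly the following: (A1) $\begin{bmatrix}0&0\\0&0\end{bmatrix}\to M$ for every vertex $M$ of type (V1), (V3) or (V6); (A2) $\begin{bmatrix}\lambda&0\\0&0\end{bmatrix}\to\begin{bmatrix}\mu&0\\0&\nu\end{bmatrix}$ (the target of type (V1)) if and only if $\lambda=\mu a+\nu b$ for some nonnegative real numbers $a,b$; (A3) $\begin{bmatrix}\lambda&0\\0&0\end{bmatrix}\to\begin{bmatrix}0&1\\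 \sigma&0\end{bmatrix}$ for all $\lambda,\sigma$ with $|\lambda|=1$, $|\sigma|<1$; (A4) $\begin{bmatrix}\lambda&0\\0&0\end{bmatrix}\to\begin{bmatrix}0&\tau\\ \tau&\tau i\end{bmatrix}$ if and only if $\operatorname{Im}(\lambda\bar\tau)\geq 0$; (A5) $\begin{bmatrix}\lambda&0\\0&0\end{bmatrix}\to\begin{bmatrix}\lambda&0\\0&\lambda\end{bmatrix}$ and $\begin{bmatrix}\lambda&0\\0&0\end{bmatrix}\to\begin{bmatrix}\lambda&0\\0&-\lambda\end{bmatrix}$, with the same value of $\lambda$ in both matrices (the targets being taken up to permutation of direct summands, so that $\operatorname{diag}(\lambda,-\lambda)$ and $\operatorname{diag}(-\lambda,\lambda)$ are the same target), and no other arrows from type (V6) to types (V4), (V5); (A6) $\begin{bmatrix}\lambda&0\\0&-\lambda\end{bmatrix}\to\begin{bmatrix}0&\tau\\ \tau&\tau i\end{bmatrix}$ if and only if $\tau=\pm\lambda$. Then $G$ is the closure graph for *congruence classes of $2\times 2$ complex matrices. That is: (i) each *congruence class of $2\times2$ complex matrices contains exactly one vertex of $G$ (where matrices that differ only by a permutation of direct summands are identified as one vertex), and distinct vertices lie in distinct classes; (ii) for any two vertices $M,N$ of $G$, there is a directed path (possibly of length $0$) from $M$ to $N$ in $G$ if and only if $M$ can be transformed by an arbitrarily small perturbation to a matrix that is *congruent to $N$. The graph is infinite: each of the types (V1)–(V6) represents infinitely many vertices. Moreover, the codimension over $\mathbb R$ of the *congruence class of a vertex is $2$ for types (V1), (V2),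 (V3); $4$ for types (V4), (V5); $5$ for type (V6); and $8$ for type (V7).
   Context: Matrices $A,B\in\mathbb C^{n\times n}$ are *congruent if $S^*AS=B$ for some nonsingular $S\in\mathbb C^{n\times n}$, where $S^*$ is the conjugate transpose. The *congruence class of $A$ is the set of all matrices *congruent to $A$. The closure graph for *congruence classes of $n\times n$ complex matrices is a directed graph in which each vertex $v$ represents in a one-to-one manner a *congruence class $C_v$ of $n\times n$ matrices, and there is a directed path from a vertex $v$ to a vertex $w$ if and only if one (and hence each) matrix from $C_v$ can be transformed to a matrix from $C_w$ by an arbitrarily small perturbation. Here "$M$ can be transformed by an arbitrarily small perturbation to a matrix in $C_w$" means that every neighborhood of $M$ in $\mathbb C^{n\times n}$ contains a matrix from $C_w$ (equivalently, $M$ lies in the closure of $C_w$). There is always a directed path of length $0$ from a vertex to itself. For $A\in\mathbb C^{n\times n}$, let $V_A:=\{C^*A+AC \mid C\in\mathbb C^{n\times n}\}$, a real vector space (the tangent space to the *congruence class of $A$ at $A$). The codimension over $\mathbb R$ of the *congruence class of $A$ is $2n^2-\dim_{\mathbb R}V_A$. *)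

theory Defs
  imports "HOL-Analysis.Analysis" "Graph_Theory.Digraph"
begin

section \<open>*Congruence of complex matrices\<close>

definition conj_transpose :: "complex^'n^'m \<Rightarrow> complex^'m^'n" where
  "conj_transpose A = (\<chi> i j. cnj (A $ j $ i))"

definition star_congruent :: "complex^'n^'n \<Rightarrow> complex^'n^'n \<Rightarrow> bool" where
  "star_congruent A B \<longleftrightarrow> (\<exists>S. invertible S \<and> conj_transpose S ** A ** S = B)"

definition star_class :: "complex^'n^'n \<Rightarrow> (complex^'n^'n) set" where
  "star_class A = {B. star_congruent A B}"

definition perturbable_into :: "complex^'n^'n \<Rightarrow> (complex^'n^'n) set \<Rightarrow> bool" where
  "perturbable_into M K \<longleftrightarrow> (\<forall>U. open U \<and> M \<in> U \<longrightarrow> U \<inter> K \<noteq> {})"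

definition tangent_space :: "complex^'n^'n \<Rightarrow> (complex^'n^'n) set" where
  "tangent_space A = {conj_transpose C ** A + A ** C | C. True}"

text \<open>\<^const>\<open>dim\<close> is the dimension over the reals.\<close>

definition star_codim :: "complex^'n^'n \<Rightarrow> int" where
  "star_codim A = 2 * int CARD('n) ^ 2 - int (dim (tangent_space A))"


section \<open>Closure graphs\<close>

text \<open>
  \<open>K v\<close> is the *congruence class represented by the vertex \<open>v\<close>.  The last two conditions express
  ``one (and hence each) matrix of \<open>K v\<close> can be perturbed into \<open>K w\<close>''.
\<close>

definition closure_graph ::
  "('v, 'e) pre_digraph \<Rightarrow> ('v \<Rightarrow> (complex^'n^'n) set) \<Rightarrow> bool" where
  "closure_graph G K \<longleftrightarrow>
     wf_digraph G \<and>
     bij_betw K (verts G) (range star_class) \<and>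
     (\<forall>v\<in>verts G. \<forall>w\<in>verts G.
        (v \<rightarrow>\<^sup>*\<^bsub>G\<^esub> w \<longleftrightarrow> (\<exists>M\<in>K v. perturbable_into M (K w))) \<and>
        (v \<rightarrow>\<^sup>*\<^bsub>G\<^esub> w \<longleftrightarrow> (\<forall>M\<in>K v. perturbable_into M (K w))))"


section \<open>The graph for two-by-two matrices\<close>

definition mat2 :: "complex \<Rightarrow> complex \<Rightarrow> complex \<Rightarrow> complex \<Rightarrow> complex^2^2" where
  "mat2 a b c d = vector [vector [a, b], vector [c, d]]"

abbreviation diag2 :: "complex \<Rightarrow> complex \<Rightarrow> complex^2^2" where
  "diag2 a b \<equiv> mat2 a 0 0 b"

definition V1 :: "(complex^2^2) set" where
  "V1 = {diag2 \<mu> \<nu> | \<mu> \<nu>. cmod \<mu> = 1 \<and> cmod \<nu> = 1 \<and> \<mu> \<noteq> \<nu> \<and> \<mu> \<noteq> - \<nu>}"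

definition V2 :: "(complex^2^2) set" where
  "V2 = {mat2 0 1 \<sigma> 0 | \<sigma>. cmod \<sigma> < 1}"

definition V3 :: "(complex^2^2) set" where
  "V3 = {mat2 0 \<tau> \<tau> (\<tau> * \<i>) | \<tau>. cmod \<tau> = 1}"

definition V4 :: "(complex^2^2) set" where
  "V4 = {diag2 l l | l. cmod l = 1}"

definition V5 :: "(complex^2^2) set" where
  "V5 = {diag2 l (- l) | l. cmod l = 1}"

definition V6 :: "(complex^2^2) set" where
  "V6 = {diag2 l 0 | l. cmod l = 1}"

definition V7 :: "(complex^2^2) set" where
  "V7 = {diag2 0 0}"

definition vertex_matrices :: "(complex^2^2) set" where
  "vertex_matrices = V1 \<union> V2 \<union> V3 \<union> V4 \<union> V5 \<union> V6 \<union> V7"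

text \<open>
  Vertices are classes of listed matrices up to permutation of direct summands.  A nontrivial
  permutation occurs only for a direct sum of two one-by-one blocks; the matrices of types
  \<^const>\<open>V2\<close> and \<^const>\<open>V3\<close> are single two-by-two summands.
\<close>

definition summand_perm :: "((complex^2^2) \<times> (complex^2^2)) set" where
  "summand_perm = {(A, B). A \<in> vertex_matrices \<and> B \<in> vertex_matrices \<and>
     (A = B \<or> (\<exists>a b. A = diag2 a b \<and> B = diag2 b a))}"

definition vertex_of :: "complex^2^2 \<Rightarrow> (complex^2^2) set" where
  "vertex_of A = summand_perm `` {A}"

inductive arrow :: "complex^2^2 \<Rightarrow> complex^2^2 \<Rightarrow> bool" where
  A1: "M \<in> V1 \<union> V3 \<union> V6 \<Longrightarrow> arrow (diag2 0 0) M"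
| A2: "\<lbrakk>diag2 l 0 \<in> V6; diag2 \<mu> \<nu> \<in> V1;
        \<exists>a b :: real. 0 \<le> a \<and> 0 \<le> b \<and> l = \<mu> * of_real a + \<nu> * of_real b\<rbrakk>
       \<Longrightarrow> arrow (diag2 l 0) (diag2 \<mu> \<nu>)"
| A3: "\<lbrakk>cmod l = 1; cmod \<sigma> < 1\<rbrakk> \<Longrightarrow> arrow (diag2 l 0) (mat2 0 1 \<sigma> 0)"
| A4: "\<lbrakk>cmod l = 1; cmod \<tau> = 1; Im (l * cnj \<tau>) \<ge> 0\<rbrakk>
       \<Longrightarrow> arrow (diag2 l 0) (mat2 0 \<tau> \<tau> (\<tau> * \<i>))"
| A5_plus: "cmod l = 1 \<Longrightarrow> arrow (diag2 l 0) (diag2 l l)"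
| A5_minus: "cmod l = 1 \<Longrightarrow> arrow (diag2 l 0) (diag2 l (- l))"
| A6: "\<lbrakk>cmod l = 1; cmod \<tau> = 1; \<tau> = l \<or> \<tau> = - l\<rbrakk>
       \<Longrightarrow> arrow (diag2 l (- l)) (mat2 0 \<tau> \<tau> (\<tau> * \<i>))"

definition graph2 ::
  "((complex^2^2) set, (complex^2^2) set \<times> (complex^2^2) set) pre_digraph" where
  "graph2 = \<lparr>verts = vertex_matrices // summand_perm,
             arcs = {(vertex_of A, vertex_of B) | A B. arrow A B},
             tail = fst, head = snd\<rparr>"

end

theory Submission
  imports Defs
begin

text \<open>
  The form \<open>det (x A + y A\<^sup>*)\<close> is multiplied by \<open>\<bar>det S\<bar>\<^sup>2\<close> under *congruence by \<open>S\<close>, so along a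
  limit of *congruent matrices its coefficients stay proportional with a nonnegative factor, and
  every diagonal entry of the limit lies in the closure of the values \<open>x\<^sup>* N x\<close>.  These two facts
  exclude every perturbation that the graph does not contain.  Conversely, a nonzero value
  \<open>l = x\<^sup>* N x\<close> puts \<open>diag(l, 0)\<close> in the closure of the class of \<open>N\<close>: complete \<open>x\<close> to a basis by
  a second vector and shrink that vector to zero.

  For the canonical form, take \<open>z\<close> and \<open>v \<noteq> 0\<close> with \<open>A v = z A\<^sup>* v\<close>.  If \<open>v\<^sup>* A v \<noteq> 0\<close>, the
  \<open>A\<close>-orthogonal complement of \<open>v\<close> diagonalizes \<open>A\<close>; otherwise \<open>v\<close> is isotropic and
  shears along \<open>v\<close> followed by rescaling finish the reduction.  Arrows strictly lower the codimension, which makes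
  *congruent vertices equal.
\<close>

section \<open>*Congruence, invariants and perturbations\<close>

lemma conj_transpose_mult: "conj_transpose (A ** B) = conj_transpose B ** conj_transpose A"
  by (simp add: conj_transpose_def matrix_matrix_mult_def vec_eq_iff mult.commute)

lemma conj_transpose_mat_1 [simp]: "conj_transpose (mat 1) = mat 1"
  by (simp add: conj_transpose_def mat_def vec_eq_iff)

lemma conj_transpose_conj_transpose [simp]: "conj_transpose (conj_transpose A) = A"
  by (simp add: conj_transpose_def vec_eq_iff)

lemma conj_transpose_add: "conj_transpose (A + B) = conj_transpose A + conj_transpose B"
  by (simp add: conj_transpose_def vec_eq_iff)

lemma star_congruent_refl: "star_congruent A A" for A :: "complex^'n^'n"
proof -
  have "invertible (mat 1 :: complex^'n^'n)"
    unfolding invertible_def by (rule exI[of _ "mat 1"]) simp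
  then show ?thesis
    unfolding star_congruent_def by (intro exI[of _ "mat 1"]) simp
qed

lemma star_congruent_trans:
  assumes "star_congruent A B" "star_congruent B C"
  shows "star_congruent A C"
proof -
  obtain S T where "invertible S" "conj_transpose S ** A ** S = B"
    "invertible T" "conj_transpose T ** B ** T = C"
    using assms unfolding star_congruent_def by blast
  then have "invertible (S ** T)" "conj_transpose (S ** T) ** A ** (S ** T) = C"
    by (auto simp: invertible_mult conj_transpose_mult matrix_mul_assoc)
  then show ?thesis unfolding star_congruent_def by blast
qed

lemma star_congruent_sym:
  assumes "star_congruent A B"
  shows "star_congruent B A"
proof -
  obtain S where S: "invertible S" "conj_transpose S ** A ** S = B"
    using assms unfolding star_congruent_def by blast
  then obtain T where T: "S ** T = mat 1" "T ** S = mat 1"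
    unfolding invertible_def by blast
  have "conj_transpose T ** B ** T = conj_transpose (S ** T) ** A ** (S ** T)"
    by (simp add: S(2)[symmetric] conj_transpose_mult matrix_mul_assoc)
  also have "\<dots> = A" by (simp add: T)
  finally show ?thesis unfolding star_congruent_def invertible_def using T by blast
qed

lemma star_class_eq_iff: "star_class A = star_class B \<longleftrightarrow> star_congruent A B"
proof
  assume "star_class A = star_class B"
  then have "B \<in> star_class A" by (simp add: star_class_def star_congruent_refl)
  then show "star_congruent A B" by (simp add: star_class_def)
next
  assume "star_congruent A B"
  then show "star_class A = star_class B"
    unfolding star_class_def
    by (auto intro: star_congruent_trans star_congruent_trans[OF star_congruent_sym])
qed

section \<open>Perturbations as closures of *congruence classes\<close>

lemma perturbable_into_iff_closure: "perturbable_into M K \<longleftrightarrow> M \<in> closure K"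
  unfolding perturbable_into_def closure_iff_nhds_not_empty
  by (intro iffI allI impI) (blast, (drule spec)+, blast)

lemma continuous_on_matrix_mult [continuous_intros]:
  fixes f :: "'a::topological_space \<Rightarrow> complex^'n^'m" and g :: "'a \<Rightarrow> complex^'k^'n"
  assumes "continuous_on X f" "continuous_on X g"
  shows "continuous_on X (\<lambda>x. f x ** g x)"
  unfolding matrix_matrix_mult_def
  by (intro continuous_intros assms)

lemma continuous_on_conj_transpose [continuous_intros]:
  assumes "continuous_on X f"
  shows "continuous_on X (\<lambda>x. conj_transpose (f x))"
  unfolding conj_transpose_def by (intro continuous_intros assms)

lemma continuous_on_det [continuous_intros]:
  fixes f :: "'a::topological_space \<Rightarrow> complex^'n^'n"
  assumes "continuous_on X f"
  shows "continuous_on X (\<lambda>x. det (f x))"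
  unfolding det_def by (intro continuous_intros assms)

text \<open>The map \<open>X \<mapsto> S\<^sup>* X S\<close> is continuous and sends the class of
  \<open>N\<close> into itself, hence also its closure into itself. Closures of classes are
  therefore unions of classes.\<close>

lemma closure_star_class_congruent:
  assumes "star_congruent A B" "A \<in> closure (star_class N)"
  shows "B \<in> closure (star_class N)"
proof -
  obtain S where S: "invertible S" "conj_transpose S ** A ** S = B"
    using assms unfolding star_congruent_def by blast
  let ?f = "\<lambda>X. conj_transpose S ** X ** S"
  have "?f ` star_class N \<subseteq> closure (star_class N)"
  proof -
    have "star_congruent X (?f X)" for X
      using S(1) unfolding star_congruent_def by blast
    then have "?f ` star_class N \<subseteq> star_class N"
      unfolding star_class_def by (auto intro: star_congruent_trans)
    then show ?thesis using closure_subset by blast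
  qed
  moreover have "continuous_on (closure (star_class N)) ?f"
    by (intro continuous_intros)
  ultimately have "?f ` closure (star_class N) \<subseteq> closure (star_class N)"
    by (intro image_closure_subset) auto
  then show ?thesis using assms S by blast
qed

text \<open>This composes perturbations along a directed path: once \<open>B\<close> is in the
  closed set \<open>closure (star_class C)\<close>, so are the whole class of \<open>B\<close> and
  the closure of that class.\<close>

lemma closure_star_class_trans:
  assumes "A \<in> closure (star_class B)" "B \<in> closure (star_class C)"
  shows "A \<in> closure (star_class C)"
proof -
  have "star_class B \<subseteq> closure (star_class C)"
    using closure_star_class_congruent[OF _ assms(2)] by (auto simp: star_class_def)
  then have "closure (star_class B) \<subseteq> closure (star_class C)"
    by (rule closure_minimal) simp
  then show ?thesis using assms(1) by (rule subsetD)
qed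

lemma in_closure_star_class: "star_congruent A B \<Longrightarrow> A \<in> closure (star_class B)"
  by (rule subsetD[OF closure_subset]) (simp add: star_class_def star_congruent_sym)

lemma closure_image_subset:
  assumes "x \<in> closure S" "continuous_on UNIV f" "f ` S \<subseteq> T" "closed T"
  shows "f x \<in> T"
proof -
  have "f ` closure S \<subseteq> T"
    using assms(2-4) by (intro image_closure_subset) (auto intro: continuous_on_subset)
  then show ?thesis using assms(1) by (rule image_subset_iff[THEN iffD1, rule_format])
qed

text \<open>For two-by-two matrices, \<open>mixed_det A\<close> is the coefficient of \<open>x y\<close> in
  \<open>det (x A + y A\<^sup>*)\<close>.  It is real, and its square minus
  \<open>4 \<bar>det A\<bar>\<^sup>2\<close> is the discriminant of that form.\<close>

definition mixed_det :: "complex^'n^'n \<Rightarrow> complex" where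
  "mixed_det A = det (A + conj_transpose A) - det A - cnj (det A)"

lemma det_conj_transpose:
  fixes A :: "complex^2^2" shows "det (conj_transpose A) = cnj (det A)"
  by (simp add: det_2 conj_transpose_def mult.commute)

lemma matrix_add_rdistrib: "(A + B) ** C = A ** C + B ** C"
  for A B :: "complex^'n^'m" and C :: "complex^'k^'n"
  by (simp add: matrix_matrix_mult_def vec_eq_iff sum.distrib distrib_right)

text \<open>On the class of \<open>N\<close> the pair \<open>I\<close> is \<open>I N\<close> times
  the factor \<open>\<bar>det S\<bar>\<^sup>2\<close>. The ray of nonnegative multiples of
  \<open>I N\<close> is closed, so it keeps its limits; the factor \<open>r\<close> may become 0
  there.\<close>

lemma closure_star_class_invariants:
  fixes M N :: "complex^2^2"
  assumes "M \<in> closure (star_class N)"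
  obtains r where "r \<ge> 0" "det M = of_real r * det N" "mixed_det M = of_real r * mixed_det N"
proof -
  define I where "I A = (det A, mixed_det A)" for A :: "complex^2^2"
  have I: "I B \<in> (\<lambda>r. r *\<^sub>R I N) ` {0..}" if B: "B \<in> star_class N" for B
  proof -
    obtain S where S: "conj_transpose S ** N ** S = B"
      using B unfolding star_class_def star_congruent_def by blast
    \<comment> \<open>Stated for arbitrary \<open>X\<close> because it is applied both to
      \<open>N\<close> and to \<open>N + N\<^sup>*\<close>, which together determine
      \<open>mixed_det\<close>.\<close>
    have scale: "det (conj_transpose S ** X ** S) = of_real ((cmod (det S))\<^sup>2) * det X" for X
      by (simp only: det_mul det_conj_transpose complex_norm_square) simp
    have "B + conj_transpose B = conj_transpose S ** (N + conj_transpose N) ** S"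
      by (simp add: S[symmetric] conj_transpose_mult matrix_mul_assoc matrix_add_ldistrib
          matrix_add_rdistrib conj_transpose_add)
    then have "I B = (cmod (det S))\<^sup>2 *\<^sub>R I N"
      unfolding I_def mixed_det_def using scale[of N] scale[of "N + conj_transpose N"] S
      by (simp add: scaleR_conv_of_real algebra_simps)
    then show ?thesis by auto
  qed
  have "closed ((\<lambda>r. r *\<^sub>R I N) ` {0::real..})"
  proof (cases "I N = 0")
    case True
    then have "(\<lambda>r. r *\<^sub>R I N) ` {0::real..} = {0}" by force
    then show ?thesis by simp
  next
    case False
    then show ?thesis
      by (intro closed_injective_linear_image linear_scale_left) (auto simp: inj_def)
  qed
  moreover have "continuous_on UNIV I"
    unfolding I_def mixed_det_def by (intro continuous_intros)
  ultimately have "I M \<in> (\<lambda>r. r *\<^sub>R I N) ` {0..}"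
    using closure_image_subset[OF assms] I by blast
  then show ?thesis using that by (auto simp: I_def scaleR_conv_of_real)
qed

text \<open>This is \<open>x\<^sup>* A x\<close>; its values fill the cone over the numerical range
  of \<open>A\<close>, and that cone is the same for *congruent matrices.\<close>

definition qform :: "complex^'n^'n \<Rightarrow> complex^'n \<Rightarrow> complex" where
  "qform A x = (\<Sum>i\<in>UNIV. \<Sum>j\<in>UNIV. cnj (x $ i) * A $ i $ j * x $ j)"

text \<open>The diagonal entry \<open>k\<close> of \<open>S\<^sup>* N S\<close> is the value of
  \<open>qform N\<close> at column \<open>k\<close> of \<open>S\<close>, and reading off an entry is
  continuous.\<close>

lemma closure_star_class_diagonal:
  assumes "M \<in> closure (star_class N)" "range (qform N) \<subseteq> T" "closed T"
  shows "M $ k $ k \<in> T"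
proof -
  have "B $ k $ k \<in> T" if B: "B \<in> star_class N" for B
  proof -
    obtain S where "conj_transpose S ** N ** S = B"
      using B unfolding star_class_def star_congruent_def by blast
    then have "B $ k $ k = qform N (\<chi> i. S $ i $ k)"
      unfolding qform_def
      by (subst sum.swap) (auto simp: matrix_matrix_mult_def conj_transpose_def sum_distrib_right)
    then show ?thesis using assms(2) by auto
  qed
  then show ?thesis
    using assms(3) by (intro closure_image_subset[OF assms(1), of "\<lambda>B. B $ k $ k" T] continuous_intros) auto
qed

section \<open>Coordinates for two-by-two matrices\<close>

lemma mat2_nth [simp]:
  "mat2 a b c d $ 1 $ 1 = a" "mat2 a b c d $ 1 $ 2 = b"
  "mat2 a b c d $ 2 $ 1 = c" "mat2 a b c d $ 2 $ 2 = d"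
  by (simp_all add: mat2_def)

lemma mat2_eq_iff: "A = B \<longleftrightarrow> A $ 1 $ 1 = B $ 1 $ 1 \<and> A $ 1 $ 2 = B $ 1 $ 2 \<and>
    A $ 2 $ 1 = B $ 2 $ 1 \<and> A $ 2 $ 2 = B $ 2 $ 2" for A B :: "complex^2^2"
  by (auto simp: vec_eq_iff forall_2)

lemma mat2_inject [simp]: "mat2 a b c d = mat2 a' b' c' d' \<longleftrightarrow> a = a' \<and> b = b' \<and> c = c' \<and> d = d'"
  by (simp add: mat2_eq_iff)

lemma mat2_cases: obtains a b c d where "A = mat2 a b c d"
  using that[of "A $ 1 $ 1" "A $ 1 $ 2" "A $ 2 $ 1" "A $ 2 $ 2"] by (simp add: mat2_eq_iff)

lemma mat2_mult: "mat2 a b c d ** mat2 a' b' c' d' =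
    mat2 (a * a' + b * c') (a * b' + b * d') (c * a' + d * c') (c * b' + d * d')"
  by (simp add: mat2_eq_iff matrix_matrix_mult_def sum_2)

lemma mat2_add: "mat2 a b c d + mat2 a' b' c' d' = mat2 (a + a') (b + b') (c + c') (d + d')"
  by (simp add: mat2_eq_iff)

lemma continuous_on_mat2 [continuous_intros]:
  assumes "continuous_on X a" "continuous_on X b" "continuous_on X c" "continuous_on X d"
  shows "continuous_on X (\<lambda>x. mat2 (a x) (b x) (c x) (d x))"
proof -
  have "mat2 (a x) (b x) (c x) (d x) = (\<chi> i j. if i = 1 then if j = 1 then a x else b x
      else if j = 1 then c x else d x)" for x
    by (simp add: mat2_eq_iff)
  moreover have "continuous_on X (\<lambda>x. (\<chi> i j. if i = 1 then if j = 1 then a x else b x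
      else if j = 1 then c x else d x) :: complex^2^2)"
  proof (intro continuous_on_vec_lambda)
    fix i j :: 2
    show "continuous_on X (\<lambda>x. if i = 1 then if j = 1 then a x else b x
      else if j = 1 then c x else d x)"
      by (cases "i = 1"; cases "j = 1") (simp_all add: assms)
  qed
  ultimately show ?thesis by simp
qed

lemma conj_transpose_mat2: "conj_transpose (mat2 a b c d) = mat2 (cnj a) (cnj c) (cnj b) (cnj d)"
  by (simp add: mat2_eq_iff conj_transpose_def)

lemma det_mat2: "det (mat2 a b c d) = a * d - b * c"
  by (simp add: det_2)

lemma mixed_det_mat2: "mixed_det (mat2 a b c d) = a * cnj d + cnj a * d - b * cnj b - c * cnj c"
  by (simp add: mixed_det_def conj_transpose_mat2 mat2_add det_mat2 algebra_simps)

lemma qform_mat2: "qform (mat2 a b c d) x =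
   cnj (x $ 1) * (a * x $ 1 + b * x $ 2) + cnj (x $ 2) * (c * x $ 1 + d * x $ 2)"
  by (simp add: qform_def sum_2 algebra_simps)

text \<open>The transforming matrix is \<open>mat2 p q r s\<close>, with columns
  \<open>(p, r)\<close> and \<open>(q, s)\<close>. Positional instantiations list its entries in the
  order \<open>p\<close>, \<open>s\<close>, \<open>q\<close>, \<open>r\<close> in which the first
  premise mentions them.\<close>

lemma star_congruent_mat2I:
  assumes "p * s - q * r \<noteq> 0"
    and "a' = cnj p * (a * p + b * r) + cnj r * (c * p + d * r)"
    and "b' = cnj p * (a * q + b * s) + cnj r * (c * q + d * s)"
    and "c' = cnj q * (a * p + b * r) + cnj s * (c * p + d * r)"
    and "d' = cnj q * (a * q + b * s) + cnj s * (c * q + d * s)"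
  shows "star_congruent (mat2 a b c d) (mat2 a' b' c' d')"
  unfolding star_congruent_def
  by (rule exI[of _ "mat2 p q r s"])
     (use assms in \<open>simp add: invertible_det_nz det_mat2 conj_transpose_mat2 mat2_mult algebra_simps\<close>)

lemma diag2_qform_in_closure:
  assumes "qform N x \<noteq> 0"
  shows "diag2 (qform N x) 0 \<in> closure (star_class N)"
proof -
  obtain a b c d where N: "N = mat2 a b c d" by (rule mat2_cases)
  have "x $ 1 \<noteq> 0 \<or> x $ 2 \<noteq> 0" using assms N qform_mat2 by auto
  then obtain q s where qs: "x $ 1 * s - q * x $ 2 \<noteq> 0"
  proof
    assume "x $ 1 \<noteq> 0"
    then show ?thesis using that[of 1 0] by simp
  next
    assume "x $ 2 \<noteq> 0"
    then show ?thesis using that[of 0 1] by simp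
  qed
  define p r where "p = x $ 1" "r = x $ 2"
  \<comment> \<open>\<open>f e\<close> is \<open>N\<close> transformed by the matrix with columns
    \<open>x\<close> and \<open>e (q, s)\<close>. This is a *congruence for
    \<open>e \<noteq> 0\<close>, and \<open>f 0\<close> is the desired limit.\<close>
  define f where "f e = mat2 (qform N x)
      (of_real e * (cnj p * (a * q + b * s) + cnj r * (c * q + d * s)))
      (of_real e * (cnj q * (a * p + b * r) + cnj s * (c * p + d * r)))
      (of_real (e * e) * (cnj q * (a * q + b * s) + cnj s * (c * q + d * s)))" for e :: real
  have f: "f e \<in> star_class N" if "e \<noteq> 0" for e
  proof -
    have "p * (of_real e * s) - (of_real e * q) * r = of_real e * (x $ 1 * s - q * x $ 2)"
      by (simp add: p_r_def algebra_simps)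
    then have "p * (of_real e * s) - (of_real e * q) * r \<noteq> 0"
      using qs that by simp
    then show ?thesis
      unfolding star_class_def f_def N mem_Collect_eq
      by (rule star_congruent_mat2I) (simp_all add: qform_mat2 p_r_def algebra_simps)
  qed
  have cont: "continuous_on UNIV f"
    unfolding f_def by (intro continuous_intros)
  have "(0::real) \<in> closure (- {0})" by (simp add: closure_complement)
  then have "f 0 \<in> closure (star_class N)"
    by (rule closure_image_subset[OF _ cont]) (use f closure_subset in auto)
  then show ?thesis by (simp add: f_def)
qed

section \<open>Codimensions\<close>

text \<open>As a real-linear map of the plane, the left-hand side has determinant
  \<open>\<bar>\<alpha>\<bar>\<^sup>2 - \<bar>\<beta>\<bar>\<^sup>2\<close>. The solution is
  Cramer's rule for the equation together with its conjugate.\<close>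

lemma real_linear_equation_solvable:
  fixes \<alpha> \<beta> w :: complex
  assumes "cmod \<alpha> \<noteq> cmod \<beta>"
  obtains z where "\<alpha> * z + \<beta> * cnj z = w"
proof -
  define \<delta> where "\<delta> = (cmod \<alpha>)\<^sup>2 - (cmod \<beta>)\<^sup>2"
  have d: "of_real \<delta> = \<alpha> * cnj \<alpha> - \<beta> * cnj \<beta>"
    by (simp add: \<delta>_def flip: complex_norm_square)
  have nz: "of_real \<delta> \<noteq> (0::complex)" 
  proof -
    have "\<delta> \<noteq> 0" using assms by (simp add: \<delta>_def power2_eq_iff_nonneg)
    then show ?thesis by simp
  qed
  have "\<alpha> * (cnj \<alpha> * w - \<beta> * cnj w) + \<beta> * cnj (cnj \<alpha> * w - \<beta> * cnj w) = of_real \<delta> * w"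
    by (simp add: d algebra_simps)
  then have "\<alpha> * ((cnj \<alpha> * w - \<beta> * cnj w) / of_real \<delta>)
      + \<beta> * cnj ((cnj \<alpha> * w - \<beta> * cnj w) / of_real \<delta>) = w"
    using nz by (simp add: field_simps)
  then show ?thesis by (rule that)
qed

lemma mat2_scaleR: "r *\<^sub>R mat2 a b c d = mat2 (r *\<^sub>R a) (r *\<^sub>R b) (r *\<^sub>R c) (r *\<^sub>R d)"
  by (simp add: mat2_eq_iff)

lemma tangent_space_mat2: "tangent_space (mat2 a b c d) = {mat2
    (cnj p * a + cnj r * c + (a * p + b * r)) (cnj p * b + cnj r * d + (a * q + b * s))
    (cnj q * a + cnj s * c + (c * p + d * r)) (cnj q * b + cnj s * d + (c * q + d * s)) | p q r s. True}"
  (is "_ = {?f p q r s | p q r s. True}")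
proof -
  have f: "conj_transpose (mat2 p q r s) ** mat2 a b c d + mat2 a b c d ** mat2 p q r s = ?f p q r s"
    for p q r s
    by (simp add: conj_transpose_mat2 mat2_mult mat2_add)
  show ?thesis
  proof (intro equalityI subsetI)
    fix X assume "X \<in> tangent_space (mat2 a b c d)"
    then obtain C where "X = conj_transpose C ** mat2 a b c d + mat2 a b c d ** C"
      unfolding tangent_space_def by blast
    moreover obtain p q r s where "C = mat2 p q r s" by (rule mat2_cases)
    ultimately show "X \<in> {?f p q r s | p q r s. True}" using f by blast
  next
    fix X assume "X \<in> {?f p q r s | p q r s. True}"
    then obtain p q r s where "X = ?f p q r s" by blast
    then have "X = conj_transpose (mat2 p q r s) ** mat2 a b c d + mat2 a b c d ** mat2 p q r s"
      by (simp only: f)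
    then show "X \<in> tangent_space (mat2 a b c d)"
      unfolding tangent_space_def by blast
  qed
qed

text \<open>The domain type of \<open>f\<close> carries the dimension, so an injective real-linear
  parametrization of the tangent space yields the codimension without exhibiting a basis. The 8 is
  the real dimension of the matrix space.\<close>

lemma star_codim_eqI:
  fixes f :: "'a::euclidean_space \<Rightarrow> complex^2^2"
  assumes "linear f" "inj f" "tangent_space A = range f"
  shows "star_codim A = 8 - int DIM('a)"
proof -
  have "dim (range f) = dim (UNIV :: 'a set)"
    using assms(1,2) by (intro dim_image_eq) (auto simp: inj_def inj_on_def)
  then show ?thesis by (simp add: star_codim_def assms(3))
qed

text \<open>Multiplying by \<open>\<mu> * \<nu>\<close> turns the expression into
  \<open>\<mu>\<^sup>2 - \<nu>\<^sup>2\<close>, because both numbers are unimodular.\<close>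

lemma unit_cross_neq:
  assumes "cmod \<mu> = 1" "cmod \<nu> = 1" "\<mu> \<noteq> \<nu>" "\<mu> \<noteq> - \<nu>"
  shows "\<mu> * cnj \<nu> - \<nu> * cnj \<mu> \<noteq> 0"
proof
  assume *: "\<mu> * cnj \<nu> - \<nu> * cnj \<mu> = 0"
  have unit: "\<mu> * cnj \<mu> = 1" "\<nu> * cnj \<nu> = 1"
    using assms complex_norm_square[of \<mu>] complex_norm_square[of \<nu>] by auto
  have "\<mu>\<^sup>2 - \<nu>\<^sup>2 = \<mu>\<^sup>2 * (\<nu> * cnj \<nu>) - \<nu>\<^sup>2 * (\<mu> * cnj \<mu>)" by (simp add: unit)
  also have "\<dots> = \<mu> * \<nu> * (\<mu> * cnj \<nu> - \<nu> * cnj \<mu>)"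
    by (simp add: algebra_simps power2_eq_square)
  finally show False using * assms(3,4) by (simp add: power2_eq_iff)
qed

text \<open>Each diagonal entry moves only along the real line through its own phase, while the
  off-diagonal entries are arbitrary: six real parameters.\<close>

lemma star_codim_V1:
  assumes "M \<in> V1"
  shows "star_codim M = 2"
proof -
  obtain \<mu> \<nu> where M: "M = diag2 \<mu> \<nu>" and mn: "cmod \<mu> = 1" "cmod \<nu> = 1" "\<mu> \<noteq> \<nu>" "\<mu> \<noteq> - \<nu>"
    using assms unfolding V1_def by blast
  define f :: "real \<times> real \<times> complex \<times> complex \<Rightarrow> _"
    where "f = (\<lambda>(x, y, p, q). mat2 (\<mu> * of_real x) p q (\<nu> * of_real y))"
  have "f (x, y, p, q) \<in> tangent_space M" for x y p q
  proof -
    define \<delta> where "\<delta> = \<mu> * cnj \<nu> - \<nu> * cnj \<mu>"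
    have nz: "\<delta> \<noteq> 0" unfolding \<delta>_def using mn by (rule unit_cross_neq)
    have cd: "cnj \<delta> = - \<delta>" by (simp add: \<delta>_def)
    \<comment> \<open>Cramer's rule in the unknowns \<open>q'\<close> and \<open>cnj r'\<close>, for
      the first off-diagonal equation and the conjugate of the second. The determinant of this
      system is \<delta>.\<close>
    define q' where "q' = (p * cnj \<nu> - \<nu> * cnj q) / \<delta>"
    define r' where "r' = (\<mu> * cnj p - cnj \<mu> * q) / \<delta>"
    have "cnj r' * \<nu> + \<mu> * q' = (\<mu> * cnj \<nu> - \<nu> * cnj \<mu>) * p / \<delta>"
      "cnj q' * \<mu> + \<nu> * r' = (\<mu> * cnj \<nu> - \<nu> * cnj \<mu>) * q / \<delta>"
      using nz by (simp_all add: q'_def r'_def cd field_simps)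
    then have "cnj r' * \<nu> + \<mu> * q' = p" "cnj q' * \<mu> + \<nu> * r' = q"
      using nz by (simp_all flip: \<delta>_def)
    then show ?thesis
      unfolding M tangent_space_mat2 mem_Collect_eq
      by (intro exI[of _ "of_real (x / 2)"] exI[of _ q'] exI[of _ r'] exI[of _ "of_real (y / 2)"])
         (simp add: f_def)
  qed
  moreover have "M' \<in> range f" if "M' \<in> tangent_space M" for M'
  proof -
    from that obtain p q r s where M': "M' = mat2
        (cnj p * \<mu> + cnj r * 0 + (\<mu> * p + 0 * r)) (cnj p * 0 + cnj r * \<nu> + (\<mu> * q + 0 * s))
        (cnj q * \<mu> + cnj s * 0 + (0 * p + \<nu> * r)) (cnj q * 0 + cnj s * \<nu> + (0 * q + \<nu> * s))"
      unfolding M tangent_space_mat2 by blast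
    have "M' = f (2 * Re p, 2 * Re s, cnj r * \<nu> + \<mu> * q, cnj q * \<mu> + \<nu> * r)"
      unfolding M' by (simp add: f_def complex_eq_iff algebra_simps)
    then show ?thesis by blast
  qed
  ultimately have "tangent_space M = range f" by auto
  moreover have "linear f"
    by (rule linearI) (auto simp: f_def mat2_add mat2_scaleR algebra_simps scaleR_conv_of_real[where 'a = complex])
  moreover have "inj f" using mn by (auto simp: inj_def f_def)
  ultimately show ?thesis using star_codim_eqI[of f M] by simp
qed

text \<open>Both diagonal entries are arbitrary because \<sigma> is not unimodular. The off-diagonal
  entries depend only on \<open>cnj p + s\<close>, which costs two real dimensions.\<close>

lemma star_codim_V2:
  assumes "M \<in> V2"
  shows "star_codim M = 2"
proof -
  obtain \<sigma> where M: "M = mat2 0 1 \<sigma> 0" and s: "cmod \<sigma> < 1"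
    using assms unfolding V2_def by blast
  define f :: "complex \<times> complex \<times> complex \<Rightarrow> _"
    where "f = (\<lambda>(x, y, z). mat2 x y (\<sigma> * cnj y) z)"
  have "f (x, y, z) \<in> tangent_space M" for x y z
  proof -
    obtain r where r: "1 * r + \<sigma> * cnj r = x"
      using real_linear_equation_solvable[of 1 \<sigma>] s by auto
    obtain q where q: "\<sigma> * q + 1 * cnj q = z"
      using real_linear_equation_solvable[of \<sigma> 1] s by auto
    show ?thesis
      unfolding M tangent_space_mat2 mem_Collect_eq
      by (rule exI[of _ 0], rule exI[of _ q], rule exI[of _ r], rule exI[of _ y])
         (use r q in \<open>auto simp: f_def algebra_simps\<close>)
  qed
  moreover have "M' \<in> range f" if "M' \<in> tangent_space M" for M'
  proof -
    from that obtain p q r s where M': "M' = mat2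
        (cnj p * 0 + cnj r * \<sigma> + (0 * p + 1 * r)) (cnj p * 1 + cnj r * 0 + (0 * q + 1 * s))
        (cnj q * 0 + cnj s * \<sigma> + (\<sigma> * p + 0 * r)) (cnj q * 1 + cnj s * 0 + (\<sigma> * q + 0 * s))"
      unfolding M tangent_space_mat2 by blast
    have "M' = f (cnj r * \<sigma> + r, cnj p + s, cnj q + \<sigma> * q)"
      unfolding M' by (simp add: f_def algebra_simps)
    then show ?thesis by blast
  qed
  ultimately have "tangent_space M = range f" by auto
  moreover have "linear f"
    by (rule linearI) (auto simp: f_def mat2_add mat2_scaleR algebra_simps)
  moreover have "inj f" by (auto simp: inj_def f_def)
  ultimately show ?thesis using star_codim_eqI[of f M] by simp
qed

lemma star_codim_V3:
  assumes "M \<in> V3"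
  shows "star_codim M = 2"
proof -
  obtain \<tau> where M: "M = mat2 0 \<tau> \<tau> (\<tau> * \<i>)" and t: "\<tau> \<noteq> 0"
    using assms unfolding V3_def by fastforce
  \<comment> \<open>After division by \<tau>, the entry below the diagonal is the conjugate of the
    one above it plus \<open>2 * \<i> * r\<close>. The parameters \<open>x\<close> and
    \<open>y\<close> are twice the real and imaginary parts of \<open>r\<close>.\<close>
  define f :: "real \<times> real \<times> complex \<times> complex \<Rightarrow> _"
    where "f = (\<lambda>(x, y, p, z). mat2 (\<tau> * of_real x) (\<tau> * p)
      (\<tau> * (cnj p + \<i> * of_real x - of_real y)) (\<tau> * z))"
  have "f (x, y, p, z) \<in> tangent_space M" for x y p z
    unfolding M tangent_space_mat2 mem_Collect_eq
    by (rule exI[of _ "cnj (p - \<i> * cnj (Complex (x / 2) (y / 2)) - of_real (Im z / 2))"],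
        rule exI[of _ "of_real (Re z / 2)"], rule exI[of _ "Complex (x / 2) (y / 2)"],
        rule exI[of _ "of_real (Im z / 2)"])
       (simp add: f_def complex_eq_iff algebra_simps)
  moreover have "M' \<in> range f" if "M' \<in> tangent_space M" for M'
  proof -
    from that obtain p q r s where M': "M' = mat2
        (cnj p * 0 + cnj r * \<tau> + (0 * p + \<tau> * r)) (cnj p * \<tau> + cnj r * (\<tau> * \<i>) + (0 * q + \<tau> * s))
        (cnj q * 0 + cnj s * \<tau> + (\<tau> * p + (\<tau> * \<i>) * r)) (cnj q * \<tau> + cnj s * (\<tau> * \<i>) + (\<tau> * q + (\<tau> * \<i>) * s))"
      unfolding M tangent_space_mat2 by blast
    have "M' = f (2 * Re r, 2 * Im r, cnj p + \<i> * cnj r + s, of_real (2 * Re q) + \<i> * of_real (2 * Re s))"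
      unfolding M' by (simp add: f_def complex_eq_iff algebra_simps)
    then show ?thesis by blast
  qed
  ultimately have "tangent_space M = range f" by auto
  moreover have "linear f"
    by (rule linearI) (auto simp: f_def mat2_add mat2_scaleR algebra_simps scaleR_conv_of_real[where 'a = complex])
  moreover have "inj f" using t by (auto simp: inj_def f_def)
  ultimately show ?thesis using star_codim_eqI[of f M] by simp
qed

text \<open>The matrix is \<open>l H\<close> with \<open>H\<close> Hermitian and invertible, and
  \<open>l (C\<^sup>* H + H C)\<close> runs through \<open>l\<close> times all Hermitian matrices, a
  real space of dimension four. The sign \<epsilon> treats both types at once.\<close>

lemma star_codim_V4_V5:
  assumes "M \<in> V4 \<union> V5"
  shows "star_codim M = 4"
proof -
  obtain l \<epsilon> where M: "M = diag2 l (l * of_real \<epsilon>)" and l: "l \<noteq> 0" and e: "\<epsilon> = 1 \<or> \<epsilon> = - 1"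
  proof -
    consider l where "M = diag2 l l" "cmod l = 1" | l where "M = diag2 l (- l)" "cmod l = 1"
      using assms unfolding V4_def V5_def by blast
    then show ?thesis
    proof cases
      case (1 l)
      then have "l \<noteq> 0" by auto
      then show ?thesis using that[of l 1] 1 by simp
    next
      case (2 l)
      then have "l \<noteq> 0" by auto
      then show ?thesis using that[of l "- 1"] 2 by simp
    qed
  qed
  define f :: "real \<times> real \<times> complex \<Rightarrow> _"
    where "f = (\<lambda>(x, y, p). mat2 (l * of_real x) (l * p) (l * cnj p) (l * of_real y))"
  have ee: "\<epsilon> * (\<epsilon> * y) = y" for y using e by auto
  have "f (x, y, p) \<in> tangent_space M" for x y p
    unfolding M tangent_space_mat2 mem_Collect_eq
    by (rule exI[of _ "of_real (x / 2)"], rule exI[of _ p], rule exI[of _ 0],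
        rule exI[of _ "of_real (\<epsilon> * y / 2)"])
       (use e in \<open>auto simp: f_def\<close>)
  moreover have "M' \<in> range f" if "M' \<in> tangent_space M" for M'
  proof -
    from that obtain p q r s where M': "M' = mat2
        (cnj p * l + cnj r * 0 + (l * p + 0 * r)) (cnj p * 0 + cnj r * (l * of_real \<epsilon>) + (l * q + 0 * s))
        (cnj q * l + cnj s * 0 + (0 * p + (l * of_real \<epsilon>) * r)) (cnj q * 0 + cnj s * (l * of_real \<epsilon>) + (0 * q + (l * of_real \<epsilon>) * s))"
      unfolding M tangent_space_mat2 by blast
    have "M' = f (2 * Re p, 2 * \<epsilon> * Re s, q + of_real \<epsilon> * cnj r)"
      unfolding M' using e by (auto simp: f_def complex_eq_iff algebra_simps)
    then show ?thesis by blast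
  qed
  ultimately have "tangent_space M = range f" by auto
  moreover have "linear f"
    by (rule linearI) (auto simp: f_def mat2_add mat2_scaleR algebra_simps scaleR_conv_of_real[where 'a = complex])
  moreover have "inj f" using l by (auto simp: inj_def f_def)
  ultimately show ?thesis using star_codim_eqI[of f M] by simp
qed

text \<open>Here the Hermitian factor has rank one, and compared with the invertible case only the
  last diagonal entry is lost.\<close>

lemma star_codim_V6:
  assumes "M \<in> V6"
  shows "star_codim M = 5"
proof -
  obtain l where M: "M = diag2 l 0" and l: "l \<noteq> 0"
    using assms unfolding V6_def by fastforce
  define f :: "real \<times> complex \<Rightarrow> _"
    where "f = (\<lambda>(x, p). mat2 (l * of_real x) (l * p) (l * cnj p) 0)"
  have "f (x, p) \<in> tangent_space M" for x p
    unfolding M tangent_space_mat2 mem_Collect_eq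
    by (rule exI[of _ "of_real (x / 2)"], rule exI[of _ p], rule exI[of _ 0], rule exI[of _ 0])
       (auto simp: f_def)
  moreover have "M' \<in> range f" if "M' \<in> tangent_space M" for M'
  proof -
    from that obtain p q r s where M': "M' = mat2
        (cnj p * l + cnj r * 0 + (l * p + 0 * r)) (cnj p * 0 + cnj r * 0 + (l * q + 0 * s))
        (cnj q * l + cnj s * 0 + (0 * p + 0 * r)) (cnj q * 0 + cnj s * 0 + (0 * q + 0 * s))"
      unfolding M tangent_space_mat2 by blast
    have "M' = f (2 * Re p, q)"
      unfolding M' by (simp add: f_def complex_eq_iff algebra_simps)
    then show ?thesis by blast
  qed
  ultimately have "tangent_space M = range f" by auto
  moreover have "linear f"
    by (rule linearI) (auto simp: f_def mat2_add mat2_scaleR algebra_simps scaleR_conv_of_real[where 'a = complex])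
  moreover have "inj f" using l by (auto simp: inj_def f_def)
  ultimately show ?thesis using star_codim_eqI[of f M] by simp
qed

lemma star_codim_V7: "M \<in> V7 \<Longrightarrow> star_codim M = 8"
proof -
  assume "M \<in> V7"
  then have "tangent_space M = {mat2 0 0 0 0}"
    by (simp add: V7_def tangent_space_mat2)
  moreover have "mat2 0 0 0 0 = 0" by (simp add: mat2_eq_iff)
  ultimately have "tangent_space M = {0}" by simp
  then show ?thesis by (simp add: star_codim_def)
qed

section \<open>Canonical forms\<close>

lemma exists_kernel_vector:
  fixes A :: "complex^'n^'n"
  assumes "det A = 0"
  obtains x where "x \<noteq> 0" "A *v x = 0"
proof -
  have "\<not> (\<exists>B. B ** A = mat 1)"
    using assms invertible_left_inverse[of A] invertible_det_nz[of A] by blast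
  then show ?thesis using that unfolding matrix_left_invertible_ker by blast
qed

lemma mat2_mult_vec: "(mat2 a b c d *v x) $ 1 = a * x $ 1 + b * x $ 2"
  "(mat2 a b c d *v x) $ 2 = c * x $ 1 + d * x $ 2"
  by (simp_all add: matrix_vector_mult_def sum_2)

lemma exists_cosquare_eigenvector:
  obtains z p r where "p \<noteq> 0 \<or> r \<noteq> 0"
    "a * p + b * r = z * (cnj a * p + cnj c * r)" "c * p + d * r = z * (cnj b * p + cnj d * r)"
proof -
  define t where "t = a * cnj d + cnj a * d - b * cnj b - c * cnj c"
  define D where "D = a * d - b * c"
  have "\<exists>z. cnj D * z\<^sup>2 - t * z + D = 0"
  proof (cases "D = 0")
    case True
    then show ?thesis by (intro exI[of _ 0]) simp
  next
    case False
    define s where "s = csqrt (t\<^sup>2 - 4 * D * cnj D)"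
    have s: "s\<^sup>2 = t\<^sup>2 - 4 * D * cnj D" by (simp add: s_def)
    have "4 * cnj D * (cnj D * ((t + s) / (2 * cnj D))\<^sup>2 - t * ((t + s) / (2 * cnj D)) + D)
        = (t + s)\<^sup>2 - 2 * t * (t + s) + 4 * D * cnj D"
      using False by (simp add: field_simps power2_eq_square)
    also have "\<dots> = s\<^sup>2 - t\<^sup>2 + 4 * D * cnj D" by (simp add: field_simps power2_eq_square)
    also have "\<dots> = 0" by (simp add: s)
    finally show ?thesis using False by (intro exI[of _ "(t + s) / (2 * cnj D)"]) auto
  qed
  then obtain z where z: "cnj D * z\<^sup>2 - t * z + D = 0" by blast
  have "det (mat2 (a - z * cnj a) (b - z * cnj c) (c - z * cnj b) (d - z * cnj d))
      = cnj D * z\<^sup>2 - t * z + D"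
    by (simp add: det_mat2 D_def t_def power2_eq_square algebra_simps)
  then obtain x where x: "x \<noteq> 0"
    "mat2 (a - z * cnj a) (b - z * cnj c) (c - z * cnj b) (d - z * cnj d) *v x = 0"
    using z exists_kernel_vector by metis
  have "x $ 1 \<noteq> 0 \<or> x $ 2 \<noteq> 0" using x(1) by (auto simp: vec_eq_iff forall_2)
  moreover have "(a - z * cnj a) * x $ 1 + (b - z * cnj c) * x $ 2 = 0"
    "(c - z * cnj b) * x $ 1 + (d - z * cnj d) * x $ 2 = 0"
    using x(2) by (simp_all add: vec_eq_iff forall_2 mat2_mult_vec)
  ultimately show ?thesis
    by (intro that[of "x $ 1" "x $ 2" z]) (auto simp: algebra_simps)
qed

lemma star_congruent_diag2_swap: "star_congruent (diag2 a b) (diag2 b a)"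
  by (rule star_congruent_mat2I[of 0 0 1 1]) auto

text \<open>Scaling by the inverse square root of the modulus leaves only the phase. Since
  \<open>sgn 0 = 0\<close>, vanishing entries fit the same formula.\<close>

lemma exists_normalizing_factor:
  obtains k where "k \<noteq> 0" "cnj k * a * k = sgn a"
proof (cases "a = 0")
  case True
  then show ?thesis using that[of 1] by simp
next
  case False
  have "of_real (sqrt (cmod a)) * of_real (sqrt (cmod a)) = (of_real (cmod a) :: complex)"
    by (simp flip: of_real_mult)
  then show ?thesis using False
    by (intro that[of "of_real (1 / sqrt (cmod a))"])
       (simp_all add: sgn_div_norm scaleR_conv_of_real divide_inverse mult_ac flip: inverse_mult_distrib)
qed

lemma star_congruent_diag2_sgn: "star_congruent (diag2 a d) (diag2 (sgn a) (sgn d))"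
proof -
  obtain p s where "p \<noteq> 0" "cnj p * a * p = sgn a" "s \<noteq> 0" "cnj s * d * s = sgn d"
    using exists_normalizing_factor by metis
  then show ?thesis
    by (intro star_congruent_mat2I[of p s 0 0]) (simp_all add: mult.assoc)
qed

lemma diag2_normal_form:
  obtains M where "M \<in> vertex_matrices" "star_congruent (diag2 a d) M"
proof -
  have unit: "cmod (sgn z) = 1" if "z \<noteq> 0" for z using that by (simp add: norm_sgn)
  consider "a = 0" "d = 0" | "a = 0" "d \<noteq> 0" | "a \<noteq> 0" "d = 0" | "a \<noteq> 0" "d \<noteq> 0" by blast
  then show ?thesis
  proof cases
    case 1
    have "diag2 0 0 \<in> vertex_matrices" by (simp add: vertex_matrices_def V7_def)
    then show ?thesis using that star_congruent_refl 1 by blast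
  next
    case 2
    have "diag2 (sgn d) 0 \<in> vertex_matrices"
      using unit[OF 2(2)] by (auto simp: vertex_matrices_def V6_def)
    moreover have "star_congruent (diag2 a d) (diag2 (sgn d) 0)"
      using star_congruent_trans[OF star_congruent_diag2_swap star_congruent_diag2_sgn[of d a]] 2 by simp
    ultimately show ?thesis using that by blast
  next
    case 3
    have "diag2 (sgn a) 0 \<in> vertex_matrices"
      using unit[OF 3(1)] by (auto simp: vertex_matrices_def V6_def)
    then show ?thesis using that star_congruent_diag2_sgn[of a d] 3 by simp
  next
    case 4
    have "diag2 (sgn a) (sgn d) \<in> vertex_matrices"
      using unit[OF 4(1)] unit[OF 4(2)]
      by (cases "sgn d = sgn a"; cases "sgn d = - sgn a")
         (auto simp: vertex_matrices_def V1_def V4_def V5_def)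
    then show ?thesis using that star_congruent_diag2_sgn by blast
  qed
qed

text \<open>A swap brings the entry of larger modulus to the upper right, and rescaling the first
  basis vector makes it 1. The other entry then has modulus less than 1.\<close>

lemma zero_diagonal_normal_form:
  assumes "cmod b \<noteq> cmod c"
  obtains M where "M \<in> vertex_matrices" "star_congruent (mat2 0 b c 0) M"
proof -
  have V2: "\<exists>M\<in>vertex_matrices. star_congruent (mat2 0 b c 0) M" if bc: "cmod c < cmod b" for b c
  proof -
    have b: "b \<noteq> 0" using bc by auto
    then have "star_congruent (mat2 0 b c 0) (mat2 0 1 (c / cnj b) 0)"
      by (intro star_congruent_mat2I[of "1 / cnj b" 1 0 0]) auto
    moreover have "mat2 0 1 (c / cnj b) 0 \<in> vertex_matrices"
      using bc b by (auto simp: vertex_matrices_def V2_def norm_divide)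
    ultimately show ?thesis by blast
  qed
  have "star_congruent (mat2 0 b c 0) (mat2 0 c b 0)"
    by (rule star_congruent_mat2I[of 0 0 1 1]) auto
  then show ?thesis
    using assms V2[of c b] V2[of b c] that star_congruent_trans
    by (metis linorder_neqE)
qed

text \<open>A shear along the isotropic first vector removes the real part \<open>x\<close> of
  \<open>d / \<tau>\<close>, and rescaling reduces the imaginary part \<open>y\<close> to its sign.
  That sign is absorbed into the parameter of \<open>V3\<close>; \<open>y = 0\<close> leads to
  \<open>V5\<close>.\<close>

lemma hyperbolic_normal_form:
  assumes "cmod \<tau> = 1"
  obtains M where "M \<in> vertex_matrices" "star_congruent (mat2 0 \<tau> \<tau> d) M"
proof -
  define x y where "x = Re (d / \<tau>)" and "y = Im (d / \<tau>)"
  have "\<tau> \<noteq> 0" using assms by auto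
  then have "d = \<tau> * (d / \<tau>)" by simp
  also have "\<dots> = \<tau> * (of_real x + \<i> * of_real y)"
    by (simp only: x_def y_def flip: complex_eq)
  finally have d: "d = \<tau> * (of_real x + \<i> * of_real y)" .
  have red: "star_congruent (mat2 0 \<tau> \<tau> d) (mat2 0 \<tau> \<tau> (\<tau> * \<i> * of_real y))"
    by (rule star_congruent_mat2I[of 1 1 "of_real (- x / 2)" 0]) (simp_all add: d algebra_simps)
  have scale: "star_congruent (mat2 0 \<tau> \<tau> (\<tau> * \<i> * of_real y))
      (mat2 0 (\<tau> * of_real (sgn y)) (\<tau> * of_real (sgn y)) (\<tau> * of_real (sgn y) * \<i>))" if "y \<noteq> 0"
  proof -
    define k where "k = sqrt \<bar>y\<bar>"
    have k: "k \<noteq> 0" "of_real k * of_real k = (of_real \<bar>y\<bar> :: complex)"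
      using that by (simp_all add: k_def flip: of_real_mult)
    have "of_real y / of_real \<bar>y\<bar> = (of_real (sgn y) :: complex)"
      using that by (simp add: sgn_if)
    then show ?thesis
      using k by (intro star_congruent_mat2I[of "of_real (sgn y * k)" "of_real (1 / k)" 0 0])
        (simp_all add: that sgn_0_0 field_simps)
  qed
  consider "y = 0" | "y \<noteq> 0" by blast
  then show ?thesis
  proof cases
    case 1
    have "star_congruent (mat2 0 \<tau> \<tau> 0) (diag2 \<tau> (- \<tau>))"
      by (rule star_congruent_mat2I[of 1 "- 1 / 2" 1 "1 / 2"]) (simp_all add: field_simps)
    moreover have "diag2 \<tau> (- \<tau>) \<in> vertex_matrices"
      using assms by (auto simp: vertex_matrices_def V5_def)
    ultimately show ?thesis using that red 1 star_congruent_trans by fastforce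
  next
    case 2
    then have "cmod (\<tau> * of_real (sgn y)) = 1" using assms by (simp add: norm_mult sgn_if)
    then have "mat2 0 (\<tau> * of_real (sgn y)) (\<tau> * of_real (sgn y)) (\<tau> * of_real (sgn y) * \<i>) \<in> vertex_matrices"
      unfolding vertex_matrices_def V3_def by blast
    then show ?thesis using that star_congruent_trans[OF red scale[OF 2]] by blast
  qed
qed

text \<open>If the moduli of \<open>b\<close> and \<open>c\<close> differ, a shear can kill
  \<open>d\<close>. If they agree and are nonzero, rescaling the isotropic vector makes both entries
  equal and unimodular without touching \<open>d\<close>.\<close>

lemma isotropic_normal_form:
  obtains M where "M \<in> vertex_matrices" "star_congruent (mat2 0 b c d) M"
proof -
  consider "b = 0" "c = 0" | "cmod b \<noteq> cmod c" | "cmod b = cmod c" "b \<noteq> 0" "c \<noteq> 0" by force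
  then show ?thesis
  proof cases
    case 1
    then show ?thesis using that diag2_normal_form by metis
  next
    case 2
    then obtain z where "c * z + b * cnj z = - d"
      using real_linear_equation_solvable[of c b] by metis
    then have z: "cnj z * b + (c * z + d) = 0" by (simp add: algebra_simps eq_neg_iff_add_eq_0)
    have "star_congruent (mat2 0 b c d) (mat2 0 b c 0)"
      by (rule star_congruent_mat2I[of 1 1 z 0]) (simp_all add: z)
    then show ?thesis
      using zero_diagonal_normal_form[OF 2] that star_congruent_trans by metis
  next
    case 3
    \<comment> \<open>The goal \<open>k * c = cnj k * b\<close> forces \<open>k\<^sup>2\<close> to
      have the phase of \<open>b / c\<close>; the modulus \<open>1 / cmod b\<close> makes the common
      entry unimodular.\<close>
    define k where "k = csqrt (b / c) / of_real (cmod b)"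
    have "cmod (csqrt (b / c)) ^ 2 = 1"
      using 3 by (simp add: norm_divide flip: norm_power)
    then have u: "cmod (csqrt (b / c)) = 1"
      by (metis norm_ge_zero power2_eq_1_iff neg_0_le_iff_le not_one_le_zero)
    have k: "cmod k * cmod b = 1" using 3 u by (simp add: k_def norm_divide)
    then have k0: "k \<noteq> 0" by auto
    have "k * (k * c) = (csqrt (b / c))\<^sup>2 * c / (of_real (cmod b))\<^sup>2"
      by (simp add: k_def power2_eq_square)
    also have "\<dots> = b / (of_real (cmod b))\<^sup>2" using 3 by simp
    also have "\<dots> = k * (cnj k * b)"
    proof -
      have "k * cnj k = of_real ((cmod k)\<^sup>2)" by (rule complex_norm_square[symmetric])
      also have "cmod k = 1 / cmod b" using k 3 by (simp add: field_simps)
      finally show ?thesis by (simp add: power_divide mult.assoc[symmetric])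
    qed
    finally have "k * c = cnj k * b" using k0 by simp
    then have "star_congruent (mat2 0 b c d) (mat2 0 (k * c) (k * c) d)"
      by (intro star_congruent_mat2I[of k 1 0 0]) (simp_all add: k0 mult.commute)
    moreover have "cmod (k * c) = 1" using k 3 by (simp add: norm_mult)
    ultimately show ?thesis
      using hyperbolic_normal_form that star_congruent_trans by metis
  qed
qed

lemma exists_star_congruent_vertex:
  obtains M where "M \<in> vertex_matrices" "star_congruent A M"
proof -
  obtain a b c d where A: "A = mat2 a b c d" by (rule mat2_cases)
  obtain z p r where pr: "p \<noteq> 0 \<or> r \<noteq> 0"
    and e1: "a * p + b * r = z * (cnj a * p + cnj c * r)"
    and e2: "c * p + d * r = z * (cnj b * p + cnj d * r)"
    by (rule exists_cosquare_eigenvector)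
  define P Q where "P = a * p + b * r" and "Q = c * p + d * r"
  define w where "w = cnj p * P + cnj r * Q"
  show ?thesis
  proof (cases "w = 0")
    case True
    \<comment> \<open>Any second column completes the isotropic vector \<open>(p, r)\<close> to a
      basis.\<close>
    obtain q s where qs: "p * s - q * r \<noteq> 0"
      using pr by (metis diff_0 diff_zero mult_1 mult_1_right mult_zero_left mult_zero_right neg_equal_0_iff_equal)
    have "star_congruent A (mat2 0 (cnj p * (a * q + b * s) + cnj r * (c * q + d * s))
        (cnj q * (a * p + b * r) + cnj s * (c * p + d * r))
        (cnj q * (a * q + b * s) + cnj s * (c * q + d * s)))"
      unfolding A using qs True
      by (intro star_congruent_mat2I[of p s q r]) (simp_all add: w_def P_def Q_def)
    then show ?thesis using isotropic_normal_form that star_congruent_trans by metis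
  next
    case False
    have z: "z \<noteq> 0" using False e1 e2 by (auto simp: w_def P_def Q_def)
    \<comment> \<open>With \<open>x = (p, r)\<close> and \<open>A x = (P, Q)\<close>, the vector
      \<open>y = (u, v)\<close> satisfies \<open>y\<^sup>* A x = 0\<close>. It is independent of
      \<open>x\<close> because the determinant of the pair is the conjugate of
      \<open>w\<close>.\<close>
    define u v where "u = - cnj Q" and "v = cnj P"
    have "cnj (p * v - u * r) = w" by (simp add: u_def v_def w_def algebra_simps)
    then have nz: "p * v - u * r \<noteq> 0" using False by (metis complex_cnj_zero)
    \<comment> \<open>The eigenvector equation makes \<open>A\<^sup>* x\<close> a multiple of
      \<open>A x\<close>, so \<open>y\<^sup>* A\<^sup>* x\<close> vanishes too; its conjugate is the
      other off-diagonal entry \<open>x\<^sup>* A y\<close>.\<close>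
    have "z * (cnj u * (cnj a * p + cnj c * r) + cnj v * (cnj b * p + cnj d * r)) = cnj u * P + cnj v * Q"
      unfolding P_def Q_def e1 e2 by (simp add: algebra_simps)
    also have "\<dots> = 0" by (simp add: u_def v_def)
    finally have "cnj (cnj u * (cnj a * p + cnj c * r) + cnj v * (cnj b * p + cnj d * r)) = 0"
      using z by simp
    then have "0 = cnj p * (a * u + b * v) + cnj r * (c * u + d * v)"
      by (simp add: algebra_simps)
    moreover have "0 = cnj u * (a * p + b * r) + cnj v * (c * p + d * r)"
      by (simp add: u_def v_def flip: P_def Q_def)
    ultimately have "star_congruent A (diag2 w (cnj u * (a * u + b * v) + cnj v * (c * u + d * v)))"
      unfolding A using nz
      by (intro star_congruent_mat2I[of p v u r]) (simp_all add: w_def P_def Q_def)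
    then show ?thesis using diag2_normal_form that star_congruent_trans by metis
  qed
qed

section \<open>Necessary conditions for perturbations\<close>

lemma unit_mult_cnj: "cmod z = 1 \<Longrightarrow> z * cnj z = 1" "cmod z = 1 \<Longrightarrow> cnj z * z = 1"
  using complex_norm_square[of z] by (simp_all add: mult.commute)

lemma unit_Im_neq_0:
  assumes "cmod \<mu> = 1" "cmod \<nu> = 1" "\<mu> \<noteq> \<nu>" "\<mu> \<noteq> - \<nu>"
  shows "Im (\<mu> * cnj \<nu>) \<noteq> 0"
  using unit_cross_neq[OF assms] by (auto simp: complex_eq_iff algebra_simps)

text \<open>The values of the form are \<open>\<mu> \<bar>x\<^sub>1\<bar>\<^sup>2 + \<nu>
  \<bar>x\<^sub>2\<bar>\<^sup>2\<close>, which lie in the closed cone spanned by \<mu> and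
  \<nu>.\<close>

lemma closure_V1_diagonal:
  assumes "M \<in> closure (star_class (diag2 \<mu> \<nu>))"
    and mn: "cmod \<mu> = 1" "cmod \<nu> = 1" "\<mu> \<noteq> \<nu>" "\<mu> \<noteq> - \<nu>"
  shows "\<exists>a b :: real. 0 \<le> a \<and> 0 \<le> b \<and> M $ k $ k = \<mu> * of_real a + \<nu> * of_real b"
proof -
  define s where "s = Im (\<mu> * cnj \<nu>)"
  have s: "s \<noteq> 0" unfolding s_def using mn by (rule unit_Im_neq_0)
  \<comment> \<open>The cone is cut out by two half-planes that test the signs of the Cramer
    coefficients. Multiplying by \<open>s\<close> instead of dividing keeps these signs for either
    orientation of \<mu> and \<nu>.\<close>
  define T where "T = {z. 0 \<le> Im (z * cnj \<nu>) * s} \<inter> {z. 0 \<le> - Im (z * cnj \<mu>) * s}"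
  have "qform (diag2 \<mu> \<nu>) x \<in> T" for x
  proof -
    have q: "qform (diag2 \<mu> \<nu>) x = \<mu> * of_real ((cmod (x $ 1))\<^sup>2) + \<nu> * of_real ((cmod (x $ 2))\<^sup>2)"
      unfolding complex_norm_square by (simp add: qform_mat2 algebra_simps)
    have "Im (qform (diag2 \<mu> \<nu>) x * cnj \<nu>) = (cmod (x $ 1))\<^sup>2 * s"
      "- Im (qform (diag2 \<mu> \<nu>) x * cnj \<mu>) = (cmod (x $ 2))\<^sup>2 * s"
      unfolding q s_def by (simp_all add: algebra_simps del: of_real_power)
    then show ?thesis by (simp add: T_def mult.assoc)
  qed
  moreover have "closed T"
    unfolding T_def by (intro closed_Int closed_Collect_le continuous_intros)
  ultimately have "M $ k $ k \<in> T"
    using closure_star_class_diagonal[OF assms(1)] by blast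
  moreover define z where "z = M $ k $ k"
  ultimately have "0 \<le> Im (z * cnj \<nu>) / s" "0 \<le> - Im (z * cnj \<mu>) / s"
    by (auto simp: T_def zero_le_mult_iff zero_le_divide_iff)
  moreover have "z = \<mu> * of_real (Im (z * cnj \<nu>) / s) + \<nu> * of_real (- Im (z * cnj \<mu>) / s)"
  proof -
    have "of_real s * z = \<mu> * of_real (Im (z * cnj \<nu>)) + \<nu> * of_real (- Im (z * cnj \<mu>))"
      by (simp add: complex_eq_iff s_def algebra_simps)
    moreover have "z = \<mu> * of_real (A / s) + \<nu> * of_real (B / s)"
      if "of_real s * z = \<mu> * of_real A + \<nu> * of_real B" for A B
      using that s by (simp add: field_simps)
    ultimately show ?thesis by blast
  qed
  ultimately show ?thesis unfolding z_def by blast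
qed

text \<open>Divided by \<tau>, a value of the form is a real number plus
  \<open>\<i> \<bar>x\<^sub>2\<bar>\<^sup>2\<close>.\<close>

lemma closure_V3_diagonal:
  assumes "M \<in> closure (star_class (mat2 0 \<tau> \<tau> (\<tau> * \<i>)))" "cmod \<tau> = 1"
  shows "0 \<le> Im (M $ k $ k * cnj \<tau>)"
proof -
  define T where "T = {z. 0 \<le> Im (z * cnj \<tau>)}"
  have "qform (mat2 0 \<tau> \<tau> (\<tau> * \<i>)) x \<in> T" for x
  proof -
    have q: "qform (mat2 0 \<tau> \<tau> (\<tau> * \<i>)) x * cnj \<tau> = (\<tau> * cnj \<tau>) *
        (cnj (x $ 1) * x $ 2 + cnj (cnj (x $ 1) * x $ 2) + \<i> * of_real ((cmod (x $ 2))\<^sup>2))"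
      unfolding complex_norm_square by (simp add: qform_mat2 algebra_simps)
    show ?thesis unfolding T_def Int_iff mem_Collect_eq q unit_mult_cnj[OF assms(2)] by simp
  qed
  moreover have "closed T"
    unfolding T_def by (intro closed_Collect_le continuous_intros)
  ultimately show ?thesis
    using closure_star_class_diagonal[OF assms(1), of T k] unfolding T_def by blast
qed

text \<open>The values are real multiples of \<open>l\<close>, with both signs possible when
  \<epsilon> is negative. Taking \<epsilon> as 1, -1 and 0 serves the types \<open>V4\<close>,
  \<open>V5\<close> and \<open>V6\<close>.\<close>

lemma closure_hermitian_diagonal:
  assumes "M \<in> closure (star_class (diag2 l (l * of_real \<epsilon>)))" "cmod l = 1"
  obtains r where "M $ k $ k = of_real r * l" "0 \<le> \<epsilon> \<Longrightarrow> 0 \<le> r"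
proof -
  define T where "T = {z. Im (z * cnj l) = 0} \<inter> {z. 0 \<le> \<epsilon> \<longrightarrow> 0 \<le> Re (z * cnj l)}"
  have "qform (diag2 l (l * of_real \<epsilon>)) x \<in> T" for x
  proof -
    have q: "qform (diag2 l (l * of_real \<epsilon>)) x * cnj l = (l * cnj l) *
        of_real ((cmod (x $ 1))\<^sup>2 + \<epsilon> * (cmod (x $ 2))\<^sup>2)"
      unfolding of_real_add of_real_mult complex_norm_square
      by (simp add: qform_mat2 algebra_simps)
    show ?thesis unfolding T_def Int_iff mem_Collect_eq q unit_mult_cnj[OF assms(2)] by simp
  qed
  moreover have "closed T"
    unfolding T_def
    by (cases "0 \<le> \<epsilon>") (auto intro!: closed_Int closed_Collect_le closed_Collect_eq continuous_intros)
  ultimately have T: "M $ k $ k \<in> T"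
    using closure_star_class_diagonal[OF assms(1), of T k] by blast
  define z where "z = M $ k $ k"
  have "z * cnj l = of_real (Re (z * cnj l))"
    using T by (simp add: T_def z_def complex_eq_iff)
  then have "z = of_real (Re (z * cnj l)) * l"
    using unit_mult_cnj[OF assms(2)] by (metis mult.assoc mult.right_neutral)
  then show ?thesis using T that[of "Re (z * cnj l)"] by (auto simp: T_def z_def)
qed

definition disc :: "complex^2^2 \<Rightarrow> real" where
  "disc A = 4 * (cmod (det A))\<^sup>2 - (Re (mixed_det A))\<^sup>2"

lemma disc_V1: assumes "M \<in> V1" shows "disc M > 0"
proof -
  obtain \<mu> \<nu> where M: "M = diag2 \<mu> \<nu>" and mn: "cmod \<mu> = 1" "cmod \<nu> = 1" "\<mu> \<noteq> \<nu>" "\<mu> \<noteq> - \<nu>"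
    using assms unfolding V1_def by blast
  define z where "z = \<mu> * cnj \<nu>"
  have "(cmod z)\<^sup>2 = 1" using mn by (simp add: z_def norm_mult)
  then have "(Re z)\<^sup>2 + (Im z)\<^sup>2 = 1" by (simp add: cmod_power2)
  moreover have "(Im z)\<^sup>2 > 0" using unit_Im_neq_0[OF mn] by (simp add: z_def)
  moreover have "Re (mixed_det M) = 2 * Re z" by (simp add: M z_def mixed_det_mat2)
  moreover have "cmod (det M) = 1" using mn by (simp add: M det_mat2 norm_mult)
  ultimately have "(Re z)\<^sup>2 < 1" "Re (mixed_det M) = 2 * Re z" "cmod (det M) = 1" by linarith+
  then show ?thesis by (simp add: disc_def power_mult_distrib)
qed

lemma V2_invariants:
  "det (mat2 0 1 \<sigma> 0) = - \<sigma>" "mixed_det (mat2 0 1 \<sigma> 0) = - of_real (1 + (cmod \<sigma>)\<^sup>2)"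
  unfolding of_real_add complex_norm_square by (simp_all add: det_mat2 mixed_det_mat2)

lemma disc_V2: assumes "M \<in> V2" shows "disc M < 0"
proof -
  obtain \<sigma> where M: "M = mat2 0 1 \<sigma> 0" and s: "cmod \<sigma> < 1"
    using assms unfolding V2_def by blast
  have "disc M = - (1 - (cmod \<sigma>)\<^sup>2)\<^sup>2"
    by (simp add: M disc_def V2_invariants power2_eq_square algebra_simps)
  moreover have "(cmod \<sigma>)\<^sup>2 < 1" using s by (simp add: abs_square_less_1)
  ultimately show ?thesis by simp
qed

lemma invariants_V3_V5:
  assumes "M \<in> V3 \<union> V5" shows "disc M = 0" "mixed_det M = - 2"
proof -
  have "(\<exists>\<tau>. cmod \<tau> = 1 \<and> M = mat2 0 \<tau> \<tau> (\<tau> * \<i>)) \<or> (\<exists>l. cmod l = 1 \<and> M = diag2 l (- l))"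
    using assms unfolding V3_def V5_def by blast
  then have "cmod (det M) = 1 \<and> mixed_det M = - 2"
    by (auto simp: det_mat2 mixed_det_mat2 norm_mult unit_mult_cnj)
  then show "disc M = 0" "mixed_det M = - 2" by (simp_all add: disc_def)
qed

lemma invariants_V4:
  assumes "M \<in> V4" shows "disc M = 0" "mixed_det M = 2"
proof -
  have "\<exists>l. cmod l = 1 \<and> M = diag2 l l" using assms unfolding V4_def by blast
  then have "cmod (det M) = 1 \<and> mixed_det M = 2"
    by (auto simp: det_mat2 mixed_det_mat2 norm_mult unit_mult_cnj)
  then show "disc M = 0" "mixed_det M = 2" by (simp_all add: disc_def)
qed

lemma invariants_V6_V7:
  assumes "M \<in> V6 \<union> V7" shows "disc M = 0" "mixed_det M = 0"
proof -
  have "\<exists>l. M = diag2 l 0" using assms unfolding V6_def V7_def by blast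
  then show "disc M = 0" "mixed_det M = 0" by (auto simp: disc_def det_mat2 mixed_det_mat2)
qed

text \<open>A nonzero \<open>disc M\<close> has the sign of \<open>disc N\<close>, which settles
  \<open>V1\<close> and \<open>V2\<close>. For the other types listed here,
  \<open>mixed_det M\<close> is 2 or -2, so \<open>r\<close> is positive and the sign of
  \<open>mixed_det\<close> separates \<open>V4\<close> from \<open>V3\<close> and
  \<open>V5\<close>.\<close>

lemma closure_star_class_type:
  assumes "M \<in> closure (star_class N)" "N \<in> vertex_matrices"
  shows "M \<in> V1 \<Longrightarrow> N \<in> V1" "M \<in> V2 \<Longrightarrow> N \<in> V2" "M \<in> V4 \<Longrightarrow> N \<in> V4"
    "M \<in> V3 \<union> V5 \<Longrightarrow> N \<in> V3 \<union> V5"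
proof -
  obtain r where r: "0 \<le> r" "det M = of_real r * det N" "mixed_det M = of_real r * mixed_det N"
    using assms(1) by (rule closure_star_class_invariants)
  have disc: "disc M = r\<^sup>2 * disc N"
    using r(1) by (simp add: disc_def r norm_mult power_mult_distrib algebra_simps)
  have N: "N \<in> V1 \<or> N \<in> V2 \<or> N \<in> V3 \<union> V5 \<or> N \<in> V4 \<or> N \<in> V6 \<union> V7"
    using assms(2) unfolding vertex_matrices_def by blast
  show "N \<in> V1" if "M \<in> V1"
  proof -
    have "disc N > 0" using disc disc_V1[OF that] by (auto simp: zero_less_mult_iff)
    then show ?thesis
      using N disc_V2[of N] invariants_V3_V5[of N] invariants_V4[of N] invariants_V6_V7[of N] by force
  qed
  show "N \<in> V2" if "M \<in> V2"
  proof -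
    have "disc N < 0" using disc disc_V2[OF that] by (auto simp: mult_less_0_iff)
    then show ?thesis
      using N disc_V1[of N] invariants_V3_V5[of N] invariants_V4[of N] invariants_V6_V7[of N] by force
  qed
  show "N \<in> V4" if "M \<in> V4"
  proof -
    have "Re (of_real r * mixed_det N) = 2" using r(3) invariants_V4[OF that] by simp
    then have *: "r * Re (mixed_det N) = 2" by simp
    then have "r \<noteq> 0" by auto
    then have "Re (mixed_det N) > 0" using * r(1) zero_less_mult_pos[of r "Re (mixed_det N)"] by simp
    moreover have "disc N = 0" using disc \<open>r \<noteq> 0\<close> invariants_V4[OF that] by simp
    ultimately show ?thesis
      using N disc_V1[of N] disc_V2[of N] invariants_V3_V5[of N] invariants_V6_V7[of N] by force
  qed
  show "N \<in> V3 \<union> V5" if "M \<in> V3 \<union> V5"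
  proof -
    have "Re (of_real r * mixed_det N) = - 2" using r(3) invariants_V3_V5[OF that] by simp
    then have *: "r * Re (mixed_det N) = - 2" by simp
    then have "r \<noteq> 0" by auto
    then have "Re (mixed_det N) < 0" using * r(1) zero_less_mult_pos[of r "- Re (mixed_det N)"] by simp
    moreover have "disc N = 0" using disc \<open>r \<noteq> 0\<close> invariants_V3_V5[OF that] by simp
    ultimately show ?thesis
      using N disc_V1[of N] disc_V2[of N] invariants_V4[of N] invariants_V6_V7[of N] by force
  qed
qed

section \<open>Vertices as permutation classes, and perturbations within \<open>V1\<close> and
  \<open>V2\<close>\<close>

lemma vertex_matrices_equiv: "equiv vertex_matrices summand_perm"
  unfolding equiv_def
  by (auto simp: summand_perm_def refl_on_def sym_def trans_def)

lemma vertex_of_eq_iff: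
  assumes "M \<in> vertex_matrices" "N \<in> vertex_matrices"
  shows "vertex_of M = vertex_of N \<longleftrightarrow> M = N \<or> (\<exists>a b. M = diag2 a b \<and> N = diag2 b a)"
  unfolding vertex_of_def
  using eq_equiv_class_iff[OF vertex_matrices_equiv assms] assms by (simp add: summand_perm_def)

lemma vertex_types_subset:
  "V1 \<subseteq> vertex_matrices" "V2 \<subseteq> vertex_matrices" "V3 \<subseteq> vertex_matrices" "V4 \<subseteq> vertex_matrices"
  "V5 \<subseteq> vertex_matrices" "V6 \<subseteq> vertex_matrices" "V7 \<subseteq> vertex_matrices"
  by (auto simp: vertex_matrices_def)

text \<open>Unimodular determinants force \<open>r = 1\<close>, so the invariants determine the pair
  of diagonal entries up to a common sign. The wrong sign is excluded because the diagonal of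
  \<open>M\<close> must lie in the cone of \<mu> and \<nu>.\<close>

lemma closure_V1_V1:
  assumes cl: "M \<in> closure (star_class N)" and "M \<in> V1" "N \<in> V1"
  shows "vertex_of M = vertex_of N"
proof -
  obtain \<mu> \<nu> where N: "N = diag2 \<mu> \<nu>" and mn: "cmod \<mu> = 1" "cmod \<nu> = 1" "\<mu> \<noteq> \<nu>" "\<mu> \<noteq> - \<nu>"
    using assms unfolding V1_def by blast
  obtain \<mu>' \<nu>' where M: "M = diag2 \<mu>' \<nu>'" and mn': "cmod \<mu>' = 1" "cmod \<nu>' = 1"
    using assms unfolding V1_def by blast
  obtain r where r: "0 \<le> r" "det M = of_real r * det N" "mixed_det M = of_real r * mixed_det N"
    using cl by (rule closure_star_class_invariants)
  have "cmod (det M) = 1" "cmod (det N) = 1" using mn mn' by (simp_all add: M N det_mat2 norm_mult)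
  then have "r = 1" using r by (simp add: norm_mult)
  then have p: "\<mu>' * \<nu>' = \<mu> * \<nu>" and t: "\<mu>' * cnj \<nu>' + cnj \<mu>' * \<nu>' = \<mu> * cnj \<nu> + cnj \<mu> * \<nu>"
    using r by (simp_all add: M N det_mat2 mixed_det_mat2)
  \<comment> \<open>For unimodular entries the sum of squares is \<open>det\<close> times
    \<open>mixed_det\<close>, hence also an invariant here.\<close>
  have sq: "a\<^sup>2 + b\<^sup>2 = a * b * (a * cnj b + cnj a * b)" if "cmod a = 1" "cmod b = 1" for a b
  proof -
    have "a * b * (a * cnj b + cnj a * b) = a\<^sup>2 * (b * cnj b) + b\<^sup>2 * (a * cnj a)"
      by (simp add: algebra_simps power2_eq_square)
    then show ?thesis by (simp add: unit_mult_cnj that)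
  qed
  have s: "\<mu>'\<^sup>2 + \<nu>'\<^sup>2 = \<mu>\<^sup>2 + \<nu>\<^sup>2"
    unfolding sq[OF mn(1,2)] sq[OF mn'] p t ..
  have "(\<mu>' + \<nu>')\<^sup>2 = (\<mu> + \<nu>)\<^sup>2"
    using s p by (simp add: power2_sum algebra_simps)
  then consider "\<mu>' + \<nu>' = \<mu> + \<nu>" | "\<mu>' + \<nu>' = - (\<mu> + \<nu>)" by (auto simp: power2_eq_iff)
  then show ?thesis
  proof cases
    case 1
    have "(\<mu>' - \<mu>) * (\<mu>' - \<nu>) = \<mu>' * \<mu>' - \<mu>' * (\<mu> + \<nu>) + \<mu> * \<nu>" by (simp add: algebra_simps)
    also have "\<dots> = 0" by (simp add: 1[symmetric] p[symmetric] algebra_simps)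
    finally have "\<mu>' = \<mu> \<or> \<mu>' = \<nu>" by simp
    then show ?thesis using 1 assms(2,3) vertex_types_subset
      by (subst vertex_of_eq_iff) (auto simp: M N)
  next
    case 2
    have "(\<mu>' + \<mu>) * (\<mu>' + \<nu>) = \<mu>' * \<mu>' - \<mu>' * - (\<mu> + \<nu>) + \<mu> * \<nu>" by (simp add: algebra_simps)
    also have "\<dots> = 0" by (simp only: 2[symmetric] p[symmetric]) (simp add: algebra_simps)
    finally have or: "\<mu>' = - \<mu> \<or> \<mu>' = - \<nu>" by (simp add: eq_neg_iff_add_eq_0)
    \<comment> \<open>If \<open>- x\<close> lay in the cone of \<open>x\<close> and
      \<open>y\<close>, then \<open>(1 + a) x = - b y\<close>; comparing moduli gives
      \<open>1 + a = b\<close> and hence \<open>x = - y\<close>.\<close>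
    have opp: False if "- x = x * of_real a + y * of_real b" "0 \<le> a" "0 \<le> b" "x \<noteq> - y" "cmod x = 1" "cmod y = 1"
      for x y :: complex and a b :: real
    proof -
      have e: "x * of_real (1 + a) = - (y * of_real b)" using that(1) by (simp add: algebra_simps eq_neg_iff_add_eq_0 neg_eq_iff_add_eq_0)
      then have "cmod (x * of_real (1 + a)) = cmod (y * of_real b)" by simp
      then have "1 + a = b" using that by (simp add: norm_mult del: of_real_add)
      then have "(x + y) * of_real b = 0" using e by (simp add: algebra_simps)
      then have "x + y = 0" using \<open>1 + a = b\<close> that by auto
      then show False using that by (simp add: eq_neg_iff_add_eq_0)
    qed
    obtain a b :: real where "0 \<le> a" "0 \<le> b" "\<mu>' = \<mu> * of_real a + \<nu> * of_real b"
      using closure_V1_diagonal[OF cl[unfolded N] mn, of 1] by (auto simp: M)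
    then have False
      using or opp[of \<mu> a \<nu> b] opp[of \<nu> b \<mu> a] mn
      by (metis add.commute minus_minus)
    then show ?thesis ..
  qed
qed

text \<open>The invariants give \<open>\<rho> = r \<sigma>\<close> and \<open>1 +
  \<bar>\<rho>\<bar>\<^sup>2 = r (1 + \<bar>\<sigma>\<bar>\<^sup>2)\<close>. Eliminating
  \<open>r\<close> yields a product whose second factor is positive, as both moduli are below 1; so
  the moduli agree and \<open>r = 1\<close>.\<close>

lemma closure_V2_V2:
  assumes cl: "M \<in> closure (star_class N)" and "M \<in> V2" "N \<in> V2"
  shows "M = N"
proof -
  obtain \<sigma> \<rho> where N: "N = mat2 0 1 \<sigma> 0" "cmod \<sigma> < 1" and M: "M = mat2 0 1 \<rho> 0" "cmod \<rho> < 1"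
    using assms unfolding V2_def by blast
  obtain r where r: "0 \<le> r" "det M = of_real r * det N" "mixed_det M = of_real r * mixed_det N"
    using cl by (rule closure_star_class_invariants)
  define x y where "x = cmod \<rho>" and "y = cmod \<sigma>"
  have rs: "\<rho> = of_real r * \<sigma>" using r(2) by (simp add: M N V2_invariants)
  then have xy: "x = r * y" using r(1) by (simp add: x_def y_def norm_mult)
  have "complex_of_real (1 + x\<^sup>2) = of_real (r * (1 + y\<^sup>2))"
    using r(3) by (simp only: M N V2_invariants x_def y_def of_real_mult mult_minus_right neg_equal_iff_equal)
  then have e: "1 + x\<^sup>2 = r * (1 + y\<^sup>2)" by (simp only: of_real_eq_iff)
  have "(x - y) * (1 - x * y) = x * (1 + y\<^sup>2) - y * (1 + x\<^sup>2)"
    by (simp add: algebra_simps power2_eq_square)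
  also have "\<dots> = y * (r * (1 + y\<^sup>2)) - y * (1 + x\<^sup>2)" by (simp add: xy)
  also have "\<dots> = 0" by (simp only: e)
  finally have "(x - y) * (1 - x * y) = 0" .
  moreover have "x * y < 1"
    using M(2) N(2) by (metis mult_strict_mono' mult_1 norm_ge_zero x_def y_def)
  ultimately have "x = y" by auto
  then have "(1 - r) * (1 + y\<^sup>2) = 0" using e by (simp add: left_diff_distrib)
  moreover have "1 + y\<^sup>2 > 0" by (simp add: add_pos_nonneg)
  ultimately have "r = 1" by simp
  then show ?thesis using rs by (simp add: M N)
qed

section \<open>The closure graph\<close>

text \<open>The one-sided parameter admits square roots and reciprocals of \<open>e\<close>. Asking
  only for values in the closure allows a limit of limits.\<close>

lemma closure_star_class_limit:
  fixes f :: "real \<Rightarrow> complex^2^2"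
  assumes "continuous_on UNIV f" "\<And>e. e > 0 \<Longrightarrow> f e \<in> closure (star_class N)"
  shows "f 0 \<in> closure (star_class N)"
proof -
  have "(0::real) \<in> closure {0<..}" by simp
  then show ?thesis
    by (rule closure_image_subset[OF _ assms(1)]) (use assms(2) in auto)
qed

lemma zero_in_closure_star_class: "diag2 0 0 \<in> closure (star_class N)"
proof -
  obtain a b c d where N: "N = mat2 a b c d" by (rule mat2_cases)
  define f where "f e = mat2 (of_real (e * e) * a) (of_real (e * e) * b) (of_real (e * e) * c)
      (of_real (e * e) * d)" for e :: real
  have "f e \<in> closure (star_class N)" if "e > 0" for e
  proof -
    have "star_congruent N (f e)"
      unfolding N f_def using that
      by (intro star_congruent_mat2I[of "of_real e" "of_real e" 0 0]) simp_all
    then show ?thesis by (rule in_closure_star_class[OF star_congruent_sym])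
  qed
  moreover have "continuous_on UNIV f" unfolding f_def by (intro continuous_intros)
  ultimately have "f 0 \<in> closure (star_class N)" by (rule closure_star_class_limit[rotated])
  then show ?thesis by (simp add: f_def)
qed

lemma diag2_value_in_closure:
  assumes "l = cnj x * (a * x + b * y) + cnj y * (c * x + d * y)" "l \<noteq> 0"
  shows "diag2 l 0 \<in> closure (star_class (mat2 a b c d))"
proof -
  have "qform (mat2 a b c d) (vector [x, y]) = l" by (simp add: qform_mat2 assms(1))
  then show ?thesis using diag2_qform_in_closure[of "mat2 a b c d" "vector [x, y]"] assms(2) by simp
qed

text \<open>On the boundary of the half-plane a nonzero \<open>l\<close> is not itself a value of
  the form. So the imaginary part is first raised by \<open>e > 0\<close>, where values are
  attained, and then \<open>e\<close> tends to 0.\<close>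

lemma diag2_in_closure_V3:
  assumes "cmod \<tau> = 1" "0 \<le> Im (l * cnj \<tau>)"
  shows "diag2 l 0 \<in> closure (star_class (mat2 0 \<tau> \<tau> (\<tau> * \<i>)))"
proof -
  define u v where "u = Re (l * cnj \<tau>)" and "v = Im (l * cnj \<tau>)"
  have "l = \<tau> * (l * cnj \<tau>)"
    using unit_mult_cnj(1)[OF assms(1)] by (metis mult.assoc mult.commute mult.right_neutral)
  also have "\<dots> = \<tau> * (of_real u + \<i> * of_real v)"
    by (simp only: u_def v_def flip: complex_eq)
  finally have l: "l = \<tau> * (of_real u + \<i> * of_real v)" .
  define f where "f e = diag2 (\<tau> * (of_real u + \<i> * of_real (v + e))) 0" for e
  have "f e \<in> closure (star_class (mat2 0 \<tau> \<tau> (\<tau> * \<i>)))" if e: "e > 0" for e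
  proof -
    \<comment> \<open>The form takes the value \<open>\<tau> (u + \<i> k\<^sup>2)\<close> at the
      vector \<open>(u / (2 k), k)\<close>.\<close>
    define k where "k = sqrt (v + e)"
    have pos: "v + e > 0" using assms(2) e by (simp add: v_def)
    then have k: "k > 0" "k * k = v + e" by (simp_all add: k_def)
    have kk: "of_real (v + e) = (of_real k * of_real k :: complex)" by (simp flip: k(2))
    show ?thesis
      unfolding f_def
    proof (rule diag2_value_in_closure)
      show "\<tau> * (of_real u + \<i> * of_real (v + e)) =
          cnj (of_real (u / (2 * k))) * (0 * of_real (u / (2 * k)) + \<tau> * of_real k) +
          cnj (of_real k) * (\<tau> * of_real (u / (2 * k)) + \<tau> * \<i> * of_real k)"
        unfolding kk using k(1) by (simp add: field_simps)
      have "Im (of_real u + \<i> * of_real (v + e)) \<noteq> 0" using pos by simp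
      then have "of_real u + \<i> * of_real (v + e) \<noteq> 0" by (metis zero_complex.simps(2))
      then show "\<tau> * (of_real u + \<i> * of_real (v + e)) \<noteq> 0" using assms(1) by auto
    qed
  qed
  moreover have "continuous_on UNIV f" unfolding f_def by (intro continuous_intros)
  ultimately have "f 0 \<in> closure (star_class (mat2 0 \<tau> \<tau> (\<tau> * \<i>)))"
    by (rule closure_star_class_limit[rotated])
  then show ?thesis by (simp add: f_def l)
qed

text \<open>Scaling the basis vectors by \<open>1 / e\<close> and \<open>e\<close> keeps the
  off-diagonal entries and shrinks the corner. The limit is a hyperbolic plane, which diagonalizes
  with either order of signs.\<close>

lemma V5_in_closure_V3:
  assumes "\<tau> = l \<or> \<tau> = - l"
  shows "diag2 l (- l) \<in> closure (star_class (mat2 0 \<tau> \<tau> (\<tau> * \<i>)))"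
proof -
  have "star_congruent (mat2 0 \<tau> \<tau> 0) (diag2 l (- l))"
    using assms
  proof
    assume "\<tau> = l"
    then show ?thesis
      by (intro star_congruent_mat2I[of 1 "- 1 / 2" 1 "1 / 2"]) (simp_all add: field_simps)
  next
    assume "\<tau> = - l"
    then show ?thesis
      by (intro star_congruent_mat2I[of 1 "1 / 2" 1 "- 1 / 2"]) (simp_all add: field_simps)
  qed
  moreover have "mat2 0 \<tau> \<tau> 0 \<in> closure (star_class (mat2 0 \<tau> \<tau> (\<tau> * \<i>)))"
  proof -
    define f where "f e = mat2 0 \<tau> \<tau> (\<tau> * \<i> * of_real (e * e))" for e
    have "f e \<in> closure (star_class (mat2 0 \<tau> \<tau> (\<tau> * \<i>)))" if "e > 0" for e
    proof -
      have "star_congruent (mat2 0 \<tau> \<tau> (\<tau> * \<i>)) (f e)"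
        unfolding f_def using that
        by (intro star_congruent_mat2I[of "of_real (1 / e)" "of_real e" 0 0]) simp_all
      then show ?thesis by (rule in_closure_star_class[OF star_congruent_sym])
    qed
    moreover have "continuous_on UNIV f" unfolding f_def by (intro continuous_intros)
    ultimately have "f 0 \<in> closure (star_class (mat2 0 \<tau> \<tau> (\<tau> * \<i>)))"
    by (rule closure_star_class_limit[rotated])
    then show ?thesis by (simp add: f_def)
  qed
  ultimately show ?thesis by (rule closure_star_class_congruent)
qed

lemma arrow_in_closure:
  assumes "arrow A B"
  shows "A \<in> closure (star_class B)"
  using assms
proof cases
  case A1
  then show ?thesis using zero_in_closure_star_class by simp
next
  case (A2 l \<mu> \<nu>)
  then obtain a b :: real where ab: "0 \<le> a" "0 \<le> b" "l = \<mu> * of_real a + \<nu> * of_real b" by blast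
  \<comment> \<open>The form \<open>diag(\<mu>, \<nu>)\<close> takes the value \<open>l\<close> at
    the vector of the square roots of \<open>a\<close> and \<open>b\<close>.\<close>
  have sq: "of_real a = (of_real (sqrt a) * of_real (sqrt a) :: complex)"
    "of_real b = (of_real (sqrt b) * of_real (sqrt b) :: complex)"
    using ab by (simp_all flip: of_real_mult)
  have "l \<noteq> 0" using A2 by (auto simp: V6_def)
  then show ?thesis
    unfolding A2(1,2)
    by (intro diag2_value_in_closure[of l "of_real (sqrt a)" _ _ "of_real (sqrt b)"])
       (simp_all add: ab(3) sq algebra_simps)
next
  case (A3 l \<sigma>)
  \<comment> \<open>The left-hand side is the value of the form at the vector \<open>(1, z)\<close>,
    so \<open>l\<close> is attained.\<close>
  obtain z where "1 * z + \<sigma> * cnj z = l"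
    using real_linear_equation_solvable[of 1 \<sigma>] A3 by auto
  moreover have "l \<noteq> 0" using A3 by auto
  ultimately show ?thesis
    unfolding A3(1,2) by (intro diag2_value_in_closure[of l 1 _ _ z]) (auto simp: algebra_simps)
next
  case (A4 l \<tau>)
  then show ?thesis using diag2_in_closure_V3 by simp
next
  case (A5_plus l)
  then have "l \<noteq> 0" by auto
  then show ?thesis
    unfolding A5_plus(1,2) by (intro diag2_value_in_closure[of l 1 _ _ 0]) auto
next
  case (A5_minus l)
  then have "l \<noteq> 0" by auto
  then show ?thesis
    unfolding A5_minus(1,2) by (intro diag2_value_in_closure[of l 1 _ _ 0]) auto
next
  case (A6 l \<tau>)
  then show ?thesis using V5_in_closure_V3 by simp
qed

section \<open>Arcs and reachability in the digraph\<close>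

lemma vertex_typeI:
  "\<lbrakk>cmod \<mu> = 1; cmod \<nu> = 1; \<mu> \<noteq> \<nu>; \<mu> \<noteq> - \<nu>\<rbrakk> \<Longrightarrow> diag2 \<mu> \<nu> \<in> V1"
  "cmod \<sigma> < 1 \<Longrightarrow> mat2 0 1 \<sigma> 0 \<in> V2"
  "cmod \<tau> = 1 \<Longrightarrow> mat2 0 \<tau> \<tau> (\<tau> * \<i>) \<in> V3"
  "cmod l = 1 \<Longrightarrow> diag2 l l \<in> V4"
  "cmod l = 1 \<Longrightarrow> diag2 l (- l) \<in> V5"
  "cmod l = 1 \<Longrightarrow> diag2 l 0 \<in> V6"
  "diag2 0 0 \<in> V7"
  unfolding V1_def V2_def V3_def V4_def V5_def V6_def V7_def by blast+

lemma arrow_vertices: "arrow A B \<Longrightarrow> A \<in> vertex_matrices \<and> B \<in> vertex_matrices"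
  unfolding vertex_matrices_def by (induction rule: arrow.induct) (auto intro: vertex_typeI)

lemma verts_graph2: "verts graph2 = vertex_of ` vertex_matrices"
  by (auto simp: graph2_def quotient_def vertex_of_def)

lemma arrow_adj: "u \<rightarrow>\<^bsub>graph2\<^esub> v \<longleftrightarrow> (\<exists>A B. u = vertex_of A \<and> v = vertex_of B \<and> arrow A B)"
  by (auto simp: graph2_def arcs_ends_conv)

interpretation graph2: wf_digraph graph2
proof
  fix e assume "e \<in> arcs graph2"
  then obtain A B where "e = (vertex_of A, vertex_of B)" "arrow A B" by (auto simp: graph2_def)
  then show "tail graph2 e \<in> verts graph2" "head graph2 e \<in> verts graph2"
    using arrow_vertices by (auto simp: verts_graph2) (auto simp: graph2_def)
qed

lemma mem_vertex:
  assumes "v \<in> verts graph2" "M \<in> v"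
  shows "M \<in> vertex_matrices" "v = vertex_of M"
proof -
  have "v \<in> vertex_matrices // summand_perm" using assms(1) by (simp add: graph2_def)
  then show "M \<in> vertex_matrices" "v = vertex_of M"
    using assms(2) vertex_matrices_equiv
    by (auto simp: vertex_of_def quotient_def summand_perm_def equiv_class_eq)
qed

lemma mem_vertex_of: "M \<in> vertex_matrices \<Longrightarrow> M \<in> vertex_of M"
  by (simp add: vertex_of_def summand_perm_def)

lemma vertex_of_eq_imp_congruent:
  assumes "M \<in> vertex_matrices" "N \<in> vertex_matrices" "vertex_of M = vertex_of N"
  shows "star_congruent M N"
  using assms star_congruent_refl star_congruent_diag2_swap by (auto simp: vertex_of_eq_iff)

text \<open>Induction along the path. A vertex can have two representatives, so \<open>N\<close> is
  generalized; changing the representative is a *congruence.\<close>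

lemma reachable_imp_closure:
  assumes "v \<rightarrow>\<^sup>*\<^bsub>graph2\<^esub> w" "M \<in> v" "N \<in> w"
  shows "M \<in> closure (star_class N)"
  using assms(1,3)
proof (induction arbitrary: N rule: graph2.reachable_induct)
  case base
  then show ?case
    using mem_vertex assms(2) vertex_of_eq_imp_congruent in_closure_star_class by metis
next
  case (step u w)
  obtain A B where AB: "u = vertex_of A" "w = vertex_of B" "arrow A B"
    using step.hyps(2) arrow_adj by blast
  then have vm: "A \<in> vertex_matrices" "B \<in> vertex_matrices" using arrow_vertices by auto
  have "M \<in> closure (star_class A)" using step.IH AB(1) mem_vertex_of[OF vm(1)] by simp
  moreover have "A \<in> closure (star_class B)" using AB(3) by (rule arrow_in_closure)
  moreover have "B \<in> closure (star_class N)"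
  proof -
    have "N \<in> vertex_matrices" "vertex_of N = vertex_of B"
      using mem_vertex[of w N] step.prems AB(2) vm(2) by (auto simp: verts_graph2)
    then show ?thesis using in_closure_star_class vertex_of_eq_imp_congruent vm(2) by metis
  qed
  ultimately show ?case using closure_star_class_trans by blast
qed

abbreviation reaches :: "complex^2^2 \<Rightarrow> complex^2^2 \<Rightarrow> bool" where
  "reaches M N \<equiv> vertex_of M \<rightarrow>\<^sup>*\<^bsub>graph2\<^esub> vertex_of N"

lemma reaches_arrow: "arrow M N \<Longrightarrow> reaches M N"
  using arrow_adj by blast

text \<open>Types \<open>V2\<close>, \<open>V4\<close> and \<open>V5\<close> are not targets of
  \<open>A1\<close>; they are reached in two steps through a suitable vertex of type
  \<open>V6\<close>.\<close>

lemma zero_reaches: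
  assumes "N \<in> vertex_matrices"
  shows "reaches (diag2 0 0) N"
proof -
  have zero: "reaches (diag2 0 0) (diag2 l 0)" if "cmod l = 1" for l
    using that by (intro reaches_arrow arrow.A1) (simp add: vertex_typeI)
  have via: "reaches (diag2 0 0) N" if "arrow (diag2 l 0) N" "cmod l = 1" for l
    using graph2.reachable_trans[OF zero[OF that(2)] reaches_arrow[OF that(1)]] .
  consider "N \<in> V1 \<union> V3 \<union> V6" | "N \<in> V2" | "N \<in> V4" | "N \<in> V5" | "N \<in> V7"
    using assms unfolding vertex_matrices_def by blast
  then show ?thesis
  proof cases
    case 1
    then show ?thesis by (intro reaches_arrow arrow.A1)
  next
    case 2
    then obtain \<sigma> where "N = mat2 0 1 \<sigma> 0" "cmod \<sigma> < 1" unfolding V2_def by blast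
    then show ?thesis using via[of 1] arrow.A3[of 1 \<sigma>] by simp
  next
    case 3
    then obtain l where "N = diag2 l l" "cmod l = 1" unfolding V4_def by blast
    then show ?thesis using via[of l] arrow.A5_plus[of l] by simp
  next
    case 4
    then obtain l where "N = diag2 l (- l)" "cmod l = 1" unfolding V5_def by blast
    then show ?thesis using via[of l] arrow.A5_minus[of l] by simp
  next
    case 5
    then show ?thesis using assms by (simp add: V7_def verts_graph2)
  qed
qed

text \<open>The diagonal entry \<open>l\<close> has to obey the bound on the values of
  \<open>N\<close>, and for each type this bound is the arrow condition. The list of types in the
  conclusion serves the comparison of codimensions.\<close>

lemma closure_V6_cases:
  assumes cl: "diag2 l 0 \<in> closure (star_class N)" and l: "cmod l = 1" and N: "N \<in> vertex_matrices"
  shows "vertex_of (diag2 l 0) = vertex_of N \<or>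
    (reaches (diag2 l 0) N \<and> N \<in> V1 \<union> V2 \<union> V3 \<union> V4 \<union> V5)"
proof -
  consider "N \<in> V1" | "N \<in> V2" | "N \<in> V3" | "N \<in> V4" | "N \<in> V5" | "N \<in> V6 \<union> V7"
    using N unfolding vertex_matrices_def by blast
  then show ?thesis
  proof cases
    case 1
    then obtain \<mu> \<nu> where N: "N = diag2 \<mu> \<nu>"
      and mn: "cmod \<mu> = 1" "cmod \<nu> = 1" "\<mu> \<noteq> \<nu>" "\<mu> \<noteq> - \<nu>"
      unfolding V1_def by blast
    have "\<exists>a b :: real. 0 \<le> a \<and> 0 \<le> b \<and> l = \<mu> * of_real a + \<nu> * of_real b"
      using closure_V1_diagonal[OF cl[unfolded N] mn, of 1] by simp
    then show ?thesis using 1 arrow.A2 reaches_arrow l vertex_typeI(6) unfolding N by blast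
  next
    case 2
    then obtain \<sigma> where "N = mat2 0 1 \<sigma> 0" "cmod \<sigma> < 1" unfolding V2_def by blast
    then show ?thesis using 2 arrow.A3 l reaches_arrow by blast
  next
    case 3
    then obtain \<tau> where N: "N = mat2 0 \<tau> \<tau> (\<tau> * \<i>)" "cmod \<tau> = 1" unfolding V3_def by blast
    have "0 \<le> Im (l * cnj \<tau>)" using closure_V3_diagonal[OF cl[unfolded N(1)] N(2), of 1] by simp
    then show ?thesis using 3 arrow.A4 l N reaches_arrow by blast
  next
    case 4
    then obtain m where N: "N = diag2 m m" "cmod m = 1" unfolding V4_def by blast
    have "diag2 l 0 \<in> closure (star_class (diag2 m (m * of_real 1)))" using cl N by simp
    then obtain r where r: "l = of_real r * m" "0 \<le> r"
      using closure_hermitian_diagonal[of "diag2 l 0" m 1 1] N by auto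
    then have "r = 1" using l N(2) by (simp add: norm_mult)
    then show ?thesis using 4 r N arrow.A5_plus l reaches_arrow by simp
  next
    case 5
    then obtain m where N': "N = diag2 m (- m)" "cmod m = 1" unfolding V5_def by blast
    have "diag2 l 0 \<in> closure (star_class (diag2 m (m * of_real (- 1))))" using cl N' by simp
    then obtain r where r: "l = of_real r * m"
      using closure_hermitian_diagonal[of "diag2 l 0" m "- 1" 1] N' by auto
    then have "\<bar>r\<bar> = 1" using l N'(2) by (simp add: norm_mult)
    then have "l = m \<or> l = - m" using r by (auto simp: abs_if split: if_splits)
    \<comment> \<open>\<open>A5_minus\<close> ends at \<open>diag(l, -l)\<close>, which for
      \<open>l = - m\<close> is \<open>N\<close> only up to a swap of the summands.\<close>
    then have "vertex_of (diag2 l (- l)) = vertex_of N"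
      using N vertex_types_subset(5) vertex_typeI(5)[OF l] by (subst vertex_of_eq_iff) (auto simp: N')
    then show ?thesis using 5 reaches_arrow[OF arrow.A5_minus[OF l]] by simp
  next
    case 6
    then obtain m where N: "N = diag2 m 0" "cmod m = 1 \<or> m = 0" unfolding V6_def V7_def by blast
    have "l = m"
      using N(2)
    proof
      assume m: "cmod m = 1"
      have "diag2 l 0 \<in> closure (star_class (diag2 m (m * of_real 0)))" using cl N by simp
      then obtain r where r: "l = of_real r * m" "0 \<le> r"
        using closure_hermitian_diagonal[of "diag2 l 0" m 0 1] m by auto
      then have "r = 1" using l m by (simp add: norm_mult)
      then show ?thesis using r by simp
    next
      assume "m = 0"
      then have "range (qform N) \<subseteq> {0}" by (auto simp: N qform_mat2)
      then show ?thesis using closure_star_class_diagonal[OF cl, of "{0}" 1] l by auto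
    qed
    then show ?thesis using N by simp
  qed
qed

text \<open>Both sides have \<open>mixed_det\<close> equal to -2, so \<open>r = 1\<close>, the
  determinants agree and \<open>t = u\<close> or \<open>t = - u\<close>. When \<open>M\<close> has
  type \<open>V3\<close>, its lower right entry then decides.\<close>

lemma closure_V3_V5_cases:
  assumes cl: "M \<in> closure (star_class N)" and M: "M \<in> V3 \<union> V5" and N: "N \<in> V3 \<union> V5"
  shows "vertex_of M = vertex_of N \<or> (reaches M N \<and> M \<in> V5 \<and> N \<in> V3)"
proof -
  have inv: "det M = det N"
  proof -
    obtain r where r: "det M = of_real r * det N" "mixed_det M = of_real r * mixed_det N"
      using cl by (rule closure_star_class_invariants)
    then have "of_real r = (1 :: complex)" using invariants_V3_V5[OF M] invariants_V3_V5[OF N] by simp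
    then show ?thesis using r by simp
  qed
  have vm: "M \<in> vertex_matrices" "N \<in> vertex_matrices" using M N vertex_types_subset by auto
  obtain t where t: "cmod t = 1" "M = mat2 0 t t (t * \<i>) \<or> M = diag2 t (- t)"
    using M unfolding V3_def V5_def by blast
  obtain u where u: "cmod u = 1" "N = mat2 0 u u (u * \<i>) \<or> N = diag2 u (- u)"
    using N unfolding V3_def V5_def by blast
  have "det M = - t\<^sup>2" "det N = - u\<^sup>2"
    using t u by (auto simp: det_mat2 power2_eq_square)
  then have tu: "t = u \<or> t = - u" using inv by (auto simp: power2_eq_iff)
  have uu: "u * cnj u = 1" using u unit_mult_cnj by blast
  consider "M = mat2 0 t t (t * \<i>)" "N = mat2 0 u u (u * \<i>)"
    | "M = mat2 0 t t (t * \<i>)" "N = diag2 u (- u)"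
    | "M = diag2 t (- t)" "N = mat2 0 u u (u * \<i>)"
    | "M = diag2 t (- t)" "N = diag2 u (- u)"
    using t(2) u(2) by blast
  then show ?thesis
  proof cases
    case 1
    have im: "0 \<le> Im (t * \<i> * cnj u)"
      using closure_V3_diagonal[OF cl[unfolded 1(2)] u(1), of 2] by (simp add: 1)
    \<comment> \<open>The sign \<open>t = - u\<close> would put the corner entry of \<open>M\<close>
      into the open lower half-plane relative to \<open>u\<close>.\<close>
    have "t * \<i> * cnj u = (if t = u then \<i> else - \<i>)"
      using tu uu by (auto simp: mult_ac)
    then have "t = u" using im by (auto split: if_splits)
    then show ?thesis using 1 by simp
  next
    case 2
    then have "M \<in> closure (star_class (diag2 u (u * of_real (- 1))))" using cl by simp
    \<comment> \<open>Impossible: the corner entry would be a real multiple of \<open>u\<close>, but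
      it equals \<open>u\<close> times \<open>\<i>\<close> or \<open>- \<i>\<close>.\<close>
    then obtain r where "t * \<i> = of_real r * u"
      using closure_hermitian_diagonal[of M u "- 1" 2] u(1) 2 by auto
    then have "(t * cnj u) * \<i> = of_real r * (u * cnj u)" by (simp add: mult_ac)
    moreover have "t * cnj u = 1 \<or> t * cnj u = - 1" using tu uu by auto
    ultimately have "\<i> = of_real r \<or> - \<i> = of_real r" using uu by auto
    then show ?thesis by (auto simp: complex_eq_iff)
  next
    case 3
    have "reaches M N" unfolding 3 by (rule reaches_arrow, rule arrow.A6) (use t u tu in auto)
    then show ?thesis using 3 t u vertex_typeI by blast
  next
    case 4
    then have "vertex_of M = vertex_of N"
      using tu vertex_of_eq_iff[OF vm] by auto
    then show ?thesis ..
  qed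
qed

text \<open>The path gives the completeness of the arrows; the drop in codimension makes the closure
  relation antisymmetric on vertices, which gives uniqueness of canonical forms.\<close>

lemma closure_vertices_cases:
  assumes cl: "M \<in> closure (star_class N)" and vm: "M \<in> vertex_matrices" "N \<in> vertex_matrices"
  shows "vertex_of M = vertex_of N \<or> (reaches M N \<and> star_codim N < star_codim M)"
proof -
  consider "M \<in> V1" | "M \<in> V2" | "M \<in> V3 \<union> V5" | "M \<in> V4" | "M \<in> V6" | "M \<in> V7"
    using vm unfolding vertex_matrices_def by blast
  then show ?thesis
  proof cases
    case 1
    then show ?thesis using closure_V1_V1[OF cl] closure_star_class_type(1)[OF cl vm(2)] by blast
  next
    case 2
    then show ?thesis using closure_V2_V2[OF cl] closure_star_class_type(2)[OF cl vm(2)] by blast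
  next
    case 3
    then show ?thesis
      using closure_V3_V5_cases[OF cl] closure_star_class_type(4)[OF cl vm(2)]
        star_codim_V3[of N] star_codim_V4_V5[of M] by force
  next
    case 4
    then have "N \<in> V4" using closure_star_class_type(3)[OF cl vm(2)] by blast
    then obtain m where N: "N = diag2 m m" "cmod m = 1" unfolding V4_def by blast
    obtain l where M: "M = diag2 l l" "cmod l = 1" using 4 unfolding V4_def by blast
    have "M \<in> closure (star_class (diag2 m (m * of_real 1)))" using cl N by simp
    then obtain r where r: "l = of_real r * m" "0 \<le> r"
      using closure_hermitian_diagonal[of M m 1 1] N M by auto
    then have "r = 1" using M N by (simp add: norm_mult)
    then show ?thesis using r M N by simp
  next
    case 5
    then obtain l where M: "M = diag2 l 0" "cmod l = 1" unfolding V6_def by blast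
    show ?thesis
      using closure_V6_cases[OF cl[unfolded M(1)] M(2) vm(2)] star_codim_V6[OF 5]
        star_codim_V1[of N] star_codim_V2[of N] star_codim_V3[of N] star_codim_V4_V5[of N]
      unfolding M(1) by force
  next
    case 6
    then have M: "M = diag2 0 0" by (simp add: V7_def)
    have "vertex_of M = vertex_of N \<or> star_codim N < star_codim M"
    proof (cases "N \<in> V7")
      case True
      then show ?thesis using M by (simp add: V7_def)
    next
      case False
      then show ?thesis
        using vm(2) star_codim_V7[OF 6] star_codim_V6[of N]
          star_codim_V1[of N] star_codim_V2[of N] star_codim_V3[of N] star_codim_V4_V5[of N]
        unfolding vertex_matrices_def by force
    qed
    then show ?thesis using zero_reaches[OF vm(2)] M by blast
  qed
qed

lemma reachable_iff_closure:
  assumes "v \<in> verts graph2" "w \<in> verts graph2" "M \<in> v" "N \<in> w"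
  shows "v \<rightarrow>\<^sup>*\<^bsub>graph2\<^esub> w \<longleftrightarrow> M \<in> closure (star_class N)"
proof
  assume "v \<rightarrow>\<^sup>*\<^bsub>graph2\<^esub> w"
  then show "M \<in> closure (star_class N)" using assms reachable_imp_closure by blast
next
  assume "M \<in> closure (star_class N)"
  then have "vertex_of M = vertex_of N \<or> reaches M N"
    using closure_vertices_cases mem_vertex assms by blast
  moreover have "v = vertex_of M" "w = vertex_of N" using mem_vertex assms by blast+
  ultimately show "v \<rightarrow>\<^sup>*\<^bsub>graph2\<^esub> w" using assms(1) by auto
qed

text \<open>*Congruent matrices lie in the closure of each other's class, so distinct vertices would
  have to drop in codimension in both directions.\<close>

lemma congruent_vertices:
  assumes "star_congruent M N" "M \<in> vertex_matrices" "N \<in> vertex_matrices"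
  shows "vertex_of M = vertex_of N"
proof (rule ccontr)
  assume "vertex_of M \<noteq> vertex_of N"
  then have "star_codim N < star_codim M" "star_codim M < star_codim N"
    using closure_vertices_cases[OF in_closure_star_class] assms star_congruent_sym by metis+
  then show False by simp
qed

section \<open>Infinitely many vertices of each type\<close>

lemma infinite_unit_circle: "infinite {z. cmod z = 1}"
proof -
  have "{-1..1} \<subseteq> Re ` {z. cmod z = 1}"
  proof
    fix x :: real assume "x \<in> {-1..1}"
    then have "x\<^sup>2 \<le> 1" by (simp add: abs_square_le_1 abs_le_iff)
    then have "cmod (Complex x (sqrt (1 - x\<^sup>2))) = 1" by (simp add: cmod_def)
    then show "x \<in> Re ` {z. cmod z = 1}" by (metis (mono_tags) complex.sel(1) image_eqI mem_Collect_eq)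
  qed
  moreover have "infinite {-1..1::real}" by (rule infinite_Icc) simp
  ultimately show ?thesis using finite_subset by blast
qed

text \<open>A vertex contains at most two matrices, so finitely many vertices cover only finitely
  many matrices.\<close>

lemma infinite_vertices:
  assumes "infinite T" "T \<subseteq> vertex_matrices"
  shows "infinite (vertex_of ` T)"
proof
  assume fin: "finite (vertex_of ` T)"
  have "finite (vertex_of M)" for M
  proof -
    have "vertex_of M \<subseteq> {M, diag2 (M $ 2 $ 2) (M $ 1 $ 1)}"
      by (auto simp: vertex_of_def summand_perm_def)
    then show ?thesis by (rule finite_subset) simp
  qed
  then have "finite (\<Union> (vertex_of ` T))" using fin by auto
  moreover have "T \<subseteq> \<Union> (vertex_of ` T)" using assms(2) mem_vertex_of by blast
  ultimately show False using assms(1) finite_subset by blast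
qed

lemma infinite_types:
  assumes "T \<in> {V1, V2, V3, V4, V5, V6}"
  shows "infinite (vertex_of ` T)"
proof -
  have image: "infinite T" if "infinite S" "f ` S \<subseteq> T" "inj_on f S"
    for S :: "complex set" and f :: "complex \<Rightarrow> complex^2^2"
    using that by (metis finite_imageD finite_subset)
  have disc: "infinite {z. cmod z < 1}"
    using uncountable_ball[of 1 "0 :: complex"] countable_finite by (auto simp: ball_def)
  \<comment> \<open>Removing 1 and -1 keeps \<open>diag2 z 1\<close> within
    \<open>V1\<close>.\<close>
  have circ: "infinite ({z. cmod z = 1} - {1, - 1})"
    using infinite_unit_circle by simp
  have "infinite T"
    using assms
  proof (elim insertE emptyE)
    assume "T = V1"
    then show ?thesis
      by (intro image[OF circ, of "\<lambda>z. diag2 z 1"]) (auto simp: V1_def inj_on_def)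
  next
    assume "T = V2"
    then show ?thesis
      by (intro image[OF disc, of "\<lambda>z. mat2 0 1 z 0"]) (auto simp: V2_def inj_on_def)
  next
    assume "T = V3"
    then show ?thesis
      by (intro image[OF infinite_unit_circle, of "\<lambda>z. mat2 0 z z (z * \<i>)"])
         (auto simp: V3_def inj_on_def)
  next
    assume "T = V4"
    then show ?thesis
      by (intro image[OF infinite_unit_circle, of "\<lambda>z. diag2 z z"]) (auto simp: V4_def inj_on_def)
  next
    assume "T = V5"
    then show ?thesis
      by (intro image[OF infinite_unit_circle, of "\<lambda>z. diag2 z (- z)"]) (auto simp: V5_def inj_on_def)
  next
    assume "T = V6"
    then show ?thesis
      by (intro image[OF infinite_unit_circle, of "\<lambda>z. diag2 z 0"]) (auto simp: V6_def inj_on_def)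
  qed
  then show ?thesis
    using assms vertex_types_subset by (intro infinite_vertices) auto
qed

text \<open>The union assigns a class to a vertex without choosing a representative; all its members
  are equal.\<close>

lemma Union_star_class_vertex:
  assumes "v \<in> verts graph2" "M \<in> v"
  shows "(\<Union>M\<in>v. star_class M) = star_class M"
proof -
  have "star_class N = star_class M" if "N \<in> v" for N
    using that assms mem_vertex vertex_of_eq_imp_congruent star_class_eq_iff by metis
  then show ?thesis using assms(2) by blast
qed

lemma vertex_nonempty: "v \<in> verts graph2 \<Longrightarrow> \<exists>M. M \<in> v"
  using mem_vertex_of by (auto simp: verts_graph2)

lemma closure_graph_graph2: "closure_graph graph2 (\<lambda>v. \<Union>M\<in>v. star_class M)"
  unfolding closure_graph_def
proof (intro conjI ballI)
  let ?K = "\<lambda>v. \<Union>M\<in>v. star_class M"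
  show "wf_digraph graph2" by (rule graph2.wf_digraph_axioms)
  show "bij_betw ?K (verts graph2) (range star_class)"
  proof (rule bij_betwI')
    fix v w assume vw: "v \<in> verts graph2" "w \<in> verts graph2"
    then obtain M N where MN: "M \<in> v" "N \<in> w" using vertex_nonempty by blast
    have "?K v = ?K w \<longleftrightarrow> star_congruent M N"
      using Union_star_class_vertex vw MN star_class_eq_iff by simp
    then show "?K v = ?K w \<longleftrightarrow> v = w"
      using congruent_vertices mem_vertex vw MN by metis
  next
    fix v assume v: "v \<in> verts graph2"
    then show "?K v \<in> range star_class"
      using vertex_nonempty Union_star_class_vertex by (metis rangeI)
  next
    fix C assume "C \<in> range (star_class :: complex^2^2 \<Rightarrow> _)"
    then obtain A :: "complex^2^2" where A: "C = star_class A" by blast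
    obtain M where M: "M \<in> vertex_matrices" "star_congruent A M" by (rule exists_star_congruent_vertex)
    then have "vertex_of M \<in> verts graph2" by (simp add: verts_graph2)
    moreover have "C = ?K (vertex_of M)"
      using Union_star_class_vertex[OF calculation mem_vertex_of] M A star_class_eq_iff by metis
    ultimately show "\<exists>v\<in>verts graph2. C = ?K v" by blast
  qed
  fix v w assume vw: "v \<in> verts graph2" "w \<in> verts graph2"
  then obtain M N where MN: "M \<in> v" "N \<in> w" using vertex_nonempty by blast
  have K: "?K v = star_class M" "?K w = star_class N" using Union_star_class_vertex vw MN by blast+
  \<comment> \<open>Independence of the representative \<open>X\<close> is what makes the
    existential and the universal condition of \<open>closure_graph\<close> equivalent.\<close>
  have "perturbable_into X (star_class N) \<longleftrightarrow> v \<rightarrow>\<^sup>*\<^bsub>graph2\<^esub> w" if "X \<in> star_class M" for X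
    using that reachable_iff_closure[OF vw MN] closure_star_class_congruent star_congruent_sym
    unfolding perturbable_into_iff_closure star_class_def by blast
  moreover have "M \<in> star_class M" by (simp add: star_class_def star_congruent_refl)
  ultimately show "v \<rightarrow>\<^sup>*\<^bsub>graph2\<^esub> w \<longleftrightarrow> (\<exists>X\<in>?K v. perturbable_into X (?K w))"
    "v \<rightarrow>\<^sup>*\<^bsub>graph2\<^esub> w \<longleftrightarrow> (\<forall>X\<in>?K v. perturbable_into X (?K w))"
    unfolding K by blast+
qed

lemma unique_vertex_in_star_class:
  fixes A :: "complex^2^2"
  shows "\<exists>!v. v \<in> verts graph2 \<and> v \<subseteq> star_class A"
proof (rule ex_ex1I)
  obtain M where M: "M \<in> vertex_matrices" "star_congruent A M" by (rule exists_star_congruent_vertex)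
  then have v: "vertex_of M \<in> verts graph2" by (simp add: verts_graph2)
  have "star_congruent A N" if "N \<in> vertex_of M" for N
    using that mem_vertex[OF v] M vertex_of_eq_imp_congruent star_congruent_trans by metis
  then show "\<exists>v. v \<in> verts graph2 \<and> v \<subseteq> star_class A"
    using v by (auto simp: star_class_def)
next
  fix v w assume *: "v \<in> verts graph2 \<and> v \<subseteq> star_class A" "w \<in> verts graph2 \<and> w \<subseteq> star_class A"
  then obtain M N where MN: "M \<in> v" "N \<in> w" using vertex_nonempty by blast
  then have "star_congruent A M" "star_congruent A N" using * by (auto simp: star_class_def)
  then have "star_congruent M N" using star_congruent_sym star_congruent_trans by blast
  then show "v = w" using congruent_vertices mem_vertex MN * by metis
qed

theorem theorem2p2:
  shows
    "closure_graph graph2 (\<lambda>v. \<Union>M\<in>v. star_class M)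
     \<and> (\<forall>A :: complex^2^2. \<exists>!v. v \<in> verts graph2 \<and> v \<subseteq> star_class A)
     \<and> (\<forall>v\<in>verts graph2. \<forall>w\<in>verts graph2. v \<noteq> w \<longrightarrow>
          (\<forall>M\<in>v. \<forall>N\<in>w. star_class M \<noteq> star_class N))
     \<and> (\<forall>v\<in>verts graph2. \<forall>w\<in>verts graph2. \<forall>M\<in>v. \<forall>N\<in>w.
          v \<rightarrow>\<^sup>*\<^bsub>graph2\<^esub> w \<longleftrightarrow> perturbable_into M (star_class N))
     \<and> (\<forall>T\<in>{V1, V2, V3, V4, V5, V6}. infinite (vertex_of ` T))
     \<and> (\<forall>M \<in> V1 \<union> V2 \<union> V3. star_codim M = 2)
     \<and> (\<forall>M \<in> V4 \<union> V5. star_codim M = 4)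
     \<and> (\<forall>M \<in> V6. star_codim M = 5)
     \<and> (\<forall>M \<in> V7. star_codim M = 8)"
proof (intro conjI ballI impI allI)
  fix v w M N
  assume "v \<in> verts graph2" "w \<in> verts graph2" "v \<noteq> w" "M \<in> v" "N \<in> w"
  then show "star_class M \<noteq> star_class N"
    using congruent_vertices mem_vertex star_class_eq_iff by metis
next
  fix v w M N
  assume "v \<in> verts graph2" "w \<in> verts graph2" "M \<in> v" "N \<in> w"
  then show "v \<rightarrow>\<^sup>*\<^bsub>graph2\<^esub> w \<longleftrightarrow> perturbable_into M (star_class N)"
    by (simp add: reachable_iff_closure perturbable_into_iff_closure)
next
  fix M assume "M \<in> V1 \<union> V2 \<union> V3"
  then show "star_codim M = 2" using star_codim_V1 star_codim_V2 star_codim_V3 by blast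
next
  fix M assume "M \<in> V4 \<union> V5"
  then show "star_codim M = 4" by (rule star_codim_V4_V5)
next
  fix T assume "T \<in> {V1, V2, V3, V4, V5, V6}"
  then show "infinite (vertex_of ` T)" by (rule infinite_types)
qed (simp_all only: closure_graph_graph2 unique_vertex_in_star_class star_codim_V6 star_codim_V7)

end
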